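(* Let $\varepsilon > 0$ be fixed. For all real $x \geq 1$ and all integers $q \geq 1$ with $q \leq x^{1/2}$, we have $$\frac{1}{\varphi(q)} \# \left\{ a \in (\mathbb{Z}/q\mathbb{Z})^{\times} : |E(x;q,a)| > \frac{x^{1/2 + \varepsilon}}{q^{3/4}} \right\} \ll x^{-\varepsilon}.$$
   Context: For real $x \geq 1$, an integer $q \geq 1$ with $q \leq x$, and $a \in (\mathbb{Z}/q\mathbb{Z})^{\times}$, let $$S(x;q,a) = \sum_{\substack{1 \leq n \leq x \\ n \equiv a \ (\mathrm{mod}\ q)}} |\mu(n)|,$$ where $\mu$ is the Möbius function, and define $E(x;q,a)$ by $$S(x;q,a) = c_q \frac{x}{q} + E(x;q,a), \qquad c_q = \prod_{p \nmid q} \left( 1 - \frac{1}{p^2} \right),$$ the product being over primes $p$ not dividing $q$. $\varphi$ is Euler's totient function. The notation $A \ll B$ means that $|A| \leq C B$ for some constant $C > 0$ depending only on $\varepsilon$ (in particular, independent of $x$ and $q$). *)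

theory Defs
  imports
    "HOL-Analysis.Analysis"
    "HOL-Computational_Algebra.Computational_Algebra"
    "HOL-Number_Theory.Number_Theory"
begin

definition moebius_mu :: "nat \<Rightarrow> int" where
  "moebius_mu n = (if squarefree n then (-1) ^ card (prime_factors n) else 0)"

definition sqfree_sum :: "real \<Rightarrow> nat \<Rightarrow> nat \<Rightarrow> real" where
  "sqfree_sum x q a =
     (\<Sum>n\<in>{n. 1 \<le> n \<and> real n \<le> x \<and> [n = a] (mod q)}. real_of_int \<bar>moebius_mu n\<bar>)"

(* The product over primes p not dividing q is indexed by all naturals, with factor 1
   at every other index. *)
definition density_factor :: "nat \<Rightarrow> nat \<Rightarrow> real" where
  "density_factor q p = (if prime p \<and> \<not> p dvd q then 1 - 1 / (real p)\<^sup>2 else 1)"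

definition density_const :: "nat \<Rightarrow> real" where
  "density_const q = (\<Prod>p. density_factor q p)"

(* prodinf is a THE-description, so it is meaningful only for convergent products. *)
lemma convergent_prod_density_factor: "convergent_prod (density_factor q)"
proof -
  have "summable (\<lambda>p. norm (density_factor q p - 1))"
  proof (rule summable_comparison_test)
    show "\<exists>N. \<forall>p\<ge>N. norm (norm (density_factor q p - 1)) \<le> 1 / (real p)\<^sup>2"
      by (auto simp: density_factor_def)
    show "summable (\<lambda>p. 1 / (real p)\<^sup>2)"
      using inverse_power_summable[of 2, where 'a = real] by (simp add: field_simps)
  qed
  thus ?thesis
    by (intro abs_convergent_prod_imp_convergent_prod)
       (simp add: abs_convergent_prod_conv_summable)
qed

definition sqfree_error :: "real \<Rightarrow> nat \<Rightarrow> nat \<Rightarrow> real" where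
  "sqfree_error x q a = sqfree_sum x q a - density_const q * (x / real q)"

end

theory Submission
  imports Defs
begin

text \<open>Writing $|\mu(n)| = \sum_{d^2 \mid n} \mu(d)$ expresses $E(x;q,a)$, up to $O(\sqrt{x}/q)$, as
  $\sum_{d \le \sqrt{x}} \mu(d) \Delta_d(a)$, where $\Delta_d(a)$ is the discrepancy of
  $\#\{m \le x/d^2 : m d^2 \equiv a\}$. The point is the variance bound
  $\sum_a |E(x;q,a)|^2 \ll x^{1+\varepsilon} / \sqrt{q}$ for $q \le \sqrt{x}$; Chebyshev's
  inequality and $q \le \tau(q) \varphi(q)$ then give the claim.

  For $d_2 \equiv s d_1$ the correlation $\sum_a \Delta_{d_1}(a) \Delta_{d_2}(a)$ is the discrepancy of the
  lattice $\{(u,v) : u \equiv s^2 v\}$ in a box of side at most $Y = \min(x/d^2, q)$, hence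
  $O(Y / \lambda(s^2))$ with $\lambda(t)$ the sup norm of a shortest vector of $\{(u,v) : u \equiv t v\}$.
  The number of pairs $(d_1, d_2)$ of size $D$ with a given ratio $s$ is likewise
  $O(D^2/q + D/\lambda(s))$. Since $\sum_t \lambda(t)^{-2} \ll \log q$ over the units $t$, and squaring
  is at most $2\tau(q)$-to-one on units, the AM-GM inequality bounds the contribution of a dyadic block by
  $q^{\varepsilon} Y (D^2/\sqrt{q} + D) \ll q^{\varepsilon} x/\sqrt{q}$.\<close>

section \<open>Lattices attached to a residue class\<close>

text \<open>Single correlations need not be small: for \<open>s = 1\<close>, which includes the
  diagonal, the lattice contains (1, 1), its minimum is 1, and the bound is only O(Y). What helps is
  rarity: O(l) units have minimum \<open>l\<close>. Hence everything is averaged over the ratio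
  \<open>s\<close>. Two minima then compete, that of the square of \<open>s\<close> in the
  correlation and that of \<open>s\<close> in the number of pairs; AM-GM separates them, so that
  only sums of inverse squares occur.

  The minimum is the only invariant of the lattice that enters. Counting along lines parallel to one
  shortest vector replaces a reduced basis, and since the square of the minimum is at most
  \<open>q\<close>, an error proportional to \<open>l / q\<close> is at most one proportional to
  \<open>1 / l\<close>.

  Whole periods of length \<open>q\<close> have no discrepancy, which explains the cap
  \<open>q\<close> in \<open>Y\<close>. The range of \<open>q\<close> is decisive where
  \<open>Y * D\<close>, at most the square root of \<open>q * x\<close>, has to be below
  \<open>x / sqrt q\<close>.\<close>

definition lattice_min :: "int \<Rightarrow> int \<Rightarrow> nat" where
  "lattice_min q t = (LEAST l. \<exists>u v. (u \<noteq> 0 \<or> v \<noteq> 0) \<and> \<bar>u\<bar> \<le> int l \<and> \<bar>v\<bar> \<le> int l \<and> [u = t * v] (mod q))"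

lemma lattice_min_le:
  assumes "[u = t * v] (mod q)" "u \<noteq> 0 \<or> v \<noteq> 0" "\<bar>u\<bar> \<le> int l" "\<bar>v\<bar> \<le> int l"
  shows "lattice_min q t \<le> l"
  unfolding lattice_min_def by (rule Least_le) (use assms in blast)

text \<open>Pigeonhole, as in Thue's lemma: with \<open>k = floor (sqrt q)\<close>, a box of
  \<open>(k + 1)^2 > q\<close> points contains two with the same residue of
  \<open>u - t * v\<close>, and their difference is the vector sought.\<close>

lemma short_lattice_vector:
  fixes q t :: int
  assumes "q > 0"
  obtains u v where "u \<noteq> 0 \<or> v \<noteq> 0" "\<bar>u\<bar> \<le> int (nat \<lfloor>sqrt q\<rfloor>)" "\<bar>v\<bar> \<le> int (nat \<lfloor>sqrt q\<rfloor>)"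
    "[u = t * v] (mod q)"
proof -
  define k where "k = nat \<lfloor>sqrt q\<rfloor>"
  define B where "B = {0..int k} \<times> {0..int k}"
  have "sqrt q < real k + 1" unfolding k_def using assms by linarith
  hence "(sqrt q)\<^sup>2 < (real k + 1)\<^sup>2" using assms by (intro power_strict_mono) auto
  hence "real_of_int q < real_of_int ((int k + 1)\<^sup>2)" using assms by simp
  hence "q < (int k + 1)\<^sup>2" by linarith
  hence "nat q < (k + 1)\<^sup>2" using assms
    by (smt (verit) int_ops(2) nat_less_iff of_nat_add of_nat_power)
  moreover have "card B = (k + 1)\<^sup>2"
  proof -
    have "nat (int k + 1) = k + 1" by simp
    thus ?thesis by (simp only: B_def card_cartesian_product power2_eq_square card_atLeastAtMost_int diff_0_right)
  qed
  moreover have "card ((\<lambda>(u, v). (u - t * v) mod q) ` B) \<le> card {0..<q}"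
    using assms by (intro card_mono) auto
  ultimately have "card ((\<lambda>(u, v). (u - t * v) mod q) ` B) < card B" by simp
  hence "\<not> inj_on (\<lambda>(u, v). (u - t * v) mod q) B" by (rule pigeonhole)
  then obtain u v u' v' where *: "(u, v) \<in> B" "(u', v') \<in> B" "(u, v) \<noteq> (u', v')"
     "(u - t * v) mod q = (u' - t * v') mod q"
    unfolding inj_on_def by auto
  have "q dvd (u - t * v) - (u' - t * v')" using *(4) by (simp add: mod_eq_dvd_iff)
  also have "\<dots> = (u - u') - t * (v - v')" by (simp add: algebra_simps)
  finally have "[u - u' = t * (v - v')] (mod q)" by (simp add: cong_iff_dvd_diff)
  moreover have "\<bar>u - u'\<bar> \<le> int k" "\<bar>v - v'\<bar> \<le> int k" using *(1,2) by (auto simp: B_def)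
  ultimately show ?thesis using that[of "u - u'" "v - v'"] *(3) by (auto simp: k_def)
qed

text \<open>By minimality some coordinate attains the minimum exactly; the height of the strips used
  for counting is this coordinate.\<close>

lemma lattice_min_witness:
  assumes "q > 0"
  obtains u v where "u \<noteq> 0 \<or> v \<noteq> 0" "\<bar>u\<bar> \<le> int (lattice_min q t)" "\<bar>v\<bar> \<le> int (lattice_min q t)"
    "[u = t * v] (mod q)" "\<bar>u\<bar> = int (lattice_min q t) \<or> \<bar>v\<bar> = int (lattice_min q t)"
proof -
  let ?P = "\<lambda>l. \<exists>u v. (u \<noteq> 0 \<or> v \<noteq> 0) \<and> \<bar>u\<bar> \<le> int l \<and> \<bar>v\<bar> \<le> int l \<and> [u = t * v] (mod q)"
  have "\<exists>l. ?P l" using short_lattice_vector[OF assms, of t] by metis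
  hence "?P (lattice_min q t)" unfolding lattice_min_def by (rule LeastI_ex)
  then obtain u v where uv: "u \<noteq> 0 \<or> v \<noteq> 0" "\<bar>u\<bar> \<le> int (lattice_min q t)" "\<bar>v\<bar> \<le> int (lattice_min q t)"
    "[u = t * v] (mod q)" by blast
  have "lattice_min q t \<le> nat (max \<bar>u\<bar> \<bar>v\<bar>)" by (rule lattice_min_le[OF uv(4,1)]) auto
  with uv show ?thesis by (intro that[of u v]) (auto simp: max_def split: if_splits)
qed

lemma lattice_min_pos: "q > 0 \<Longrightarrow> lattice_min q t > 0"
  by (rule lattice_min_witness[of q t]) auto

lemma lattice_min_square_le:
  fixes q t :: int
  assumes "q > 0" shows "(lattice_min q t)\<^sup>2 \<le> q"
proof -
  define k where "k = nat \<lfloor>sqrt q\<rfloor>"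
  have "lattice_min q t \<le> k"
    by (rule short_lattice_vector[OF assms, of t]) (use lattice_min_le k_def in blast)
  hence "(real (lattice_min q t))\<^sup>2 \<le> (real k)\<^sup>2" by (intro power_mono) auto
  also have "\<dots> \<le> (sqrt q)\<^sup>2" unfolding k_def using assms by (intro power_mono) auto
  also have "\<dots> = q" using assms by simp
  finally have "real_of_int (int ((lattice_min q t)\<^sup>2)) \<le> real_of_int q" by simp
  thus ?thesis by linarith
qed

lemma lattice_min_cong:
  assumes "[t = t'] (mod q)" shows "lattice_min q t = lattice_min q t'"
proof -
  have "[u = t * v] (mod q) \<longleftrightarrow> [u = t' * v] (mod q)" for u v
    using assms by (meson cong_scalar_right cong_sym cong_trans)
  thus ?thesis by (simp add: lattice_min_def)
qed

lemma lattice_swap_cong: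
  fixes t t' :: int
  assumes "[t * t' = 1] (mod q)"
  shows "[u = t * v] (mod q) \<longleftrightarrow> [v = t' * u] (mod q)"
proof
  have *: "[t * t' * w = w] (mod q)" for w using cong_scalar_right[OF assms, of w] by simp
  show "[v = t' * u] (mod q)" if "[u = t * v] (mod q)"
    using cong_scalar_left[OF that, of t'] *[of v] by (metis (no_types) cong_sym cong_trans mult.assoc mult.commute)
  show "[u = t * v] (mod q)" if "[v = t' * u] (mod q)"
    using cong_scalar_left[OF that, of t] *[of u] by (metis (no_types) cong_sym cong_trans mult.assoc)
qed

lemma lattice_min_inverse:
  assumes "[t * t' = 1] (mod q)" shows "lattice_min q t' = lattice_min q t"
  unfolding lattice_min_def lattice_swap_cong[OF assms] by (intro arg_cong[where f = Least]) auto

section \<open>Lattice points in boxes\<close>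

definition lattice_pts :: "int \<Rightarrow> int \<Rightarrow> int set \<Rightarrow> int set \<Rightarrow> (int \<times> int) set" where
  "lattice_pts q t A B = {(u, v). u \<in> A \<and> v \<in> B \<and> [u = t * v] (mod q)}"

lemma finite_lattice_pts [simp]: "finite A \<Longrightarrow> finite B \<Longrightarrow> finite (lattice_pts q t A B)"
  by (rule finite_subset[of _ "A \<times> B"]) (auto simp: lattice_pts_def)

lemma card_lattice_pts_swap:
  assumes "[t * t' = 1] (mod q)"
  shows "card (lattice_pts q t A B) = card (lattice_pts q t' B A)"
  by (rule bij_betw_same_card[of prod.swap], rule bij_betw_byWitness[of _ prod.swap])
     (use lattice_swap_cong[OF assms] in \<open>auto simp: lattice_pts_def\<close>)

lemma card_int_between:
  fixes S :: "int set" and a b :: real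
  assumes "\<And>k. k \<in> S \<Longrightarrow> a \<le> of_int k \<and> of_int k \<le> b" "a \<le> b"
  shows "finite S" "card S \<le> b - a + 1"
proof -
  have sub: "S \<subseteq> {\<lceil>a\<rceil>..\<lfloor>b\<rfloor>}" using assms(1) by (auto simp: ceiling_le_iff le_floor_iff)
  thus "finite S" by (rule finite_subset) simp
  have "card S \<le> card {\<lceil>a\<rceil>..\<lfloor>b\<rfloor>}" using sub by (intro card_mono) auto
  hence "card S \<le> nat (\<lfloor>b\<rfloor> - \<lceil>a\<rceil> + 1)" by simp
  thus "card S \<le> b - a + 1" using assms(2) by linarith
qed

text \<open>On the rows of one period of a shortest vector $(u_0, v_0)$, a lattice point is determined
  by the line parallel to $(u_0, v_0)$ that contains it, that is, by the integer
  $(u v_0 - v u_0) / q$.\<close>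

lemma card_lattice_pts_block_le:
  assumes q: "q > 0" and u0: "[u0 = t * int l] (mod q)" "\<bar>u0\<bar> \<le> int l" and l: "l = lattice_min q t"
  shows "card (lattice_pts q t {U<..U + int F} {V<..V + int l}) \<le> real F * l / q + 2"
proof -
  define S where "S = lattice_pts q t {U<..U + int F} {V<..V + int l}"
  define k where "k = (\<lambda>(u, v). (u * int l - v * u0) div q)"
  define k0 where "k0 = U * int l - V * u0"
  have lpos: "l > 0" using lattice_min_pos[OF q] l by simp
  have kq: "k (u, v) * q = u * int l - v * u0" if "[u = t * v] (mod q)" for u v
  proof -
    have "[u * int l - v * u0 = t * v * int l - v * (t * int l)] (mod q)"
      by (intro cong_diff cong_mult that cong_refl u0)
    hence "q dvd u * int l - v * u0" by (simp add: cong_iff_dvd_diff algebra_simps)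
    thus ?thesis by (simp add: k_def)
  qed
  have inj: "inj_on k S"
  proof (rule inj_onI, clarify)
    fix u v u' v' assume *: "(u, v) \<in> S" "(u', v') \<in> S" and eq: "k (u, v) = k (u', v')"
    have c: "[u = t * v] (mod q)" "[u' = t * v'] (mod q)" using * by (auto simp: S_def lattice_pts_def)
    have "u * int l - v * u0 = u' * int l - v' * u0" using kq[OF c(1)] kq[OF c(2)] eq by simp
    \<comment> \<open>Points on one line differ by a vector parallel to \<open>(u0, int l)\<close>.
      Within a block the second coordinates differ by less than \<open>l\<close>, and
      \<open>\<bar>u0\<bar> \<le> int l\<close> passes this on to the first ones, so a nonzero
      difference would be a lattice vector shorter than the minimum.\<close>
    hence par: "(u - u') * int l = (v - v') * u0" by (simp add: algebra_simps)
    have dv: "\<bar>v - v'\<bar> < int l" using * by (auto simp: S_def lattice_pts_def)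
    have "\<bar>u - u'\<bar> * int l = \<bar>v - v'\<bar> * \<bar>u0\<bar>" using par by (metis abs_mult abs_of_nat)
    also have "\<dots> \<le> \<bar>v - v'\<bar> * int l" using u0(2) by (intro mult_left_mono) auto
    finally have du: "\<bar>u - u'\<bar> \<le> \<bar>v - v'\<bar>" using lpos by simp
    show "u = u' \<and> v = v'"
    proof (rule ccontr)
      assume ne: "\<not> (u = u' \<and> v = v')"
      have "[u - u' = t * (v - v')] (mod q)" using cong_diff[OF c] by (simp add: algebra_simps)
      hence "l \<le> nat \<bar>v - v'\<bar>" unfolding l
        by (rule lattice_min_le) (use ne du in auto)
      thus False using dv by simp
    qed
  qed
  \<comment> \<open>\<open>a\<close> and \<open>b\<close> enclose the line index \<open>K\<close>,
    because \<open>K * q = k0 + (u - U) * int l - (v - V) * u0\<close>; the sign of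
    \<open>u0\<close> is not known, hence \<open>max\<close> and \<open>min\<close>. The width is
    \<open>(F * l + l * |u0|) / q\<close>, whose second part is at most 1. Counting integers in the
    interval adds another 1, which makes the 2 of the bound.\<close>
  define a where "a = (of_int (k0 - max 0 (int l * u0)) / of_int q :: real)"
  define b where "b = (of_int (k0 + int F * int l - min 0 (int l * u0)) / of_int q :: real)"
  have ll: "int l * \<bar>u0\<bar> \<le> q"
  proof -
    have "int l * \<bar>u0\<bar> \<le> int l * int l" using u0(2) by (intro mult_left_mono) auto
    also have "\<dots> \<le> q" using lattice_min_square_le[OF q, of t] l by (simp add: power2_eq_square)
    finally show ?thesis .
  qed
  have "b - a = of_int (int F * int l + \<bar>int l * u0\<bar>) / of_int q"
    unfolding a_def b_def diff_divide_distrib[symmetric] of_int_diff[symmetric]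
    by (intro arg_cong2[where f = "(/)"] arg_cong[where f = of_int]) (auto simp: max_def min_def)
  also have "\<dots> = real F * l / q + of_int (int l * \<bar>u0\<bar>) / q" by (simp add: add_divide_distrib abs_mult)
  finally have ba: "b - a = real F * l / q + of_int (int l * \<bar>u0\<bar>) / q" .
  have "real_of_int (int l * \<bar>u0\<bar>) \<le> real_of_int q" using ll by (rule of_int_le_iff[THEN iffD2])
  hence "of_int (int l * \<bar>u0\<bar>) / q \<le> (1::real)" using q by simp
  hence ba1: "b - a \<le> real F * l / q + 1" using ba by linarith
  have ba0: "a \<le> b"
  proof -
    have "0 \<le> real F * l / q + of_int (int l * \<bar>u0\<bar>) / q" using q by (intro add_nonneg_nonneg divide_nonneg_pos) auto
    thus ?thesis using ba by linarith
  qed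
  have rng: "a \<le> of_int K \<and> of_int K \<le> b" if K: "K \<in> k ` S" for K
  proof -
    obtain u v where uv: "(u, v) \<in> S" "K = k (u, v)" using K by auto
    have c: "[u = t * v] (mod q)" and u: "U < u" "u \<le> U + int F" and v: "V < v" "v \<le> V + int l"
      using uv(1) by (auto simp: S_def lattice_pts_def)
    have "K * q = k0 + (u - U) * int l - (v - V) * u0" using kq[OF c] uv(2) by (simp add: k0_def algebra_simps)
    moreover have "0 \<le> (u - U) * int l" "(u - U) * int l \<le> int F * int l"
      using u by (auto intro!: mult_right_mono)
    moreover have "min 0 (int l * u0) \<le> (v - V) * u0 \<and> (v - V) * u0 \<le> max 0 (int l * u0)"
    proof (cases "u0 \<ge> 0")
      case True
      hence "0 \<le> (v - V) * u0" "(v - V) * u0 \<le> int l * u0" using v by (auto intro!: mult_right_mono)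
      thus ?thesis by linarith
    next
      case False
      hence "(v - V) * u0 \<le> 0" "int l * u0 \<le> (v - V) * u0" using v by (auto intro!: mult_right_mono_neg mult_nonneg_nonpos)
      thus ?thesis by linarith
    qed
    ultimately have *: "k0 - max 0 (int l * u0) \<le> K * q \<and> K * q \<le> k0 + int F * int l - min 0 (int l * u0)" by linarith
    have "of_int (k0 - max 0 (int l * u0)) \<le> (of_int (K * q) :: real)"
         "of_int (K * q) \<le> (of_int (k0 + int F * int l - min 0 (int l * u0)) :: real)"
      using * by (simp_all only: of_int_le_iff)
    thus ?thesis using q unfolding a_def b_def
      by (simp add: divide_le_eq le_divide_eq)
  qed
  have "card S = card (k ` S)" using card_image[OF inj] by simp
  also have "\<dots> \<le> b - a + 1" by (rule card_int_between(2)[OF rng ba0])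
  finally show ?thesis using ba1 unfolding S_def by simp
qed

lemma card_lattice_pts_blocks_le:
  assumes q: "q > 0" and u0: "[u0 = t * int l] (mod q)" "\<bar>u0\<bar> \<le> int l" and l: "l = lattice_min q t"
  shows "card (lattice_pts q t {U<..U + int F} {0<..int (N * l)}) \<le> N * (real F * l / q + 2)"
proof (induction N)
  case 0
  have "lattice_pts q t {U<..U + int F} {0<..int (0 * l)} = {}" by (auto simp: lattice_pts_def)
  thus ?case by simp
next
  case (Suc N)
  have "lattice_pts q t {U<..U + int F} {0<..int (Suc N * l)} \<subseteq>
        lattice_pts q t {U<..U + int F} {0<..int (N * l)} \<union>
        lattice_pts q t {U<..U + int F} {int (N * l)<..int (N * l) + int l}"
    by (auto simp: lattice_pts_def algebra_simps)
  hence "card (lattice_pts q t {U<..U + int F} {0<..int (Suc N * l)}) \<le>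
    card (lattice_pts q t {U<..U + int F} {0<..int (N * l)} \<union>
        lattice_pts q t {U<..U + int F} {int (N * l)<..int (N * l) + int l})"
    by (intro card_mono finite_UnI finite_lattice_pts) auto
  also have "\<dots> \<le> card (lattice_pts q t {U<..U + int F} {0<..int (N * l)}) +
        card (lattice_pts q t {U<..U + int F} {int (N * l)<..int (N * l) + int l})"
    by (rule card_Un_le)
  finally have "card (lattice_pts q t {U<..U + int F} {0<..int (Suc N * l)}) \<le>
      card (lattice_pts q t {U<..U + int F} {0<..int (N * l)}) +
        card (lattice_pts q t {U<..U + int F} {int (N * l)<..int (N * l) + int l})" .
  hence "real (card (lattice_pts q t {U<..U + int F} {0<..int (Suc N * l)})) \<le>
      real N * (real F * l / q + 2) + (real F * l / q + 2)"
    using Suc.IH card_lattice_pts_block_le[OF assms, of U F "int (N * l)"] by linarith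
  thus ?case by (simp add: distrib_right)
qed

text \<open>The box is covered by \<open>F2 div l + 1\<close> strips of height \<open>l\<close>; the
  four terms come from expanding \<open>(F2 / l + 1) * (F1 * l / q + 2)\<close>.\<close>

lemma card_lattice_pts_le:
  assumes q: "q > 0" and u0: "[u0 = t * int l] (mod q)" "\<bar>u0\<bar> \<le> int l" and l: "l = lattice_min q t"
  shows "card (lattice_pts q t {0<..int F1} {0<..int F2}) \<le> real F1 * F2 / q + 2 * real F2 / l + real F1 * l / q + 2"
proof -
  have lpos: "l > 0" using lattice_min_pos[OF q] l by simp
  define N where "N = F2 div l"
  have "F2 \<le> Suc N * l" using lpos dividend_less_times_div[of l F2] by (simp add: N_def algebra_simps)
  hence "card (lattice_pts q t {0<..int F1} {0<..int F2}) \<le> card (lattice_pts q t {0<..int F1} {0<..int (Suc N * l)})"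
    by (intro card_mono finite_lattice_pts) (fastforce simp: lattice_pts_def simp del: mult_Suc of_nat_mult)+
  hence "real (card (lattice_pts q t {0<..int F1} {0<..int F2})) \<le> card (lattice_pts q t {0<..int F1} {0<..int (Suc N * l)})"
    by linarith
  also have "\<dots> \<le> Suc N * (real F1 * l / q + 2)"
    using card_lattice_pts_blocks_le[OF assms, of 0 F1 "Suc N"] by simp
  also have "\<dots> \<le> (F2 / l + 1) * (real F1 * l / q + 2)"
  proof (rule mult_right_mono)
    have "N * l \<le> F2" by (simp add: N_def)
    hence "real N * real l \<le> real F2" by (metis of_nat_le_iff of_nat_mult)
    thus "real (Suc N) \<le> F2 / l + 1" using lpos by (simp add: field_simps)
  qed (use q in auto)
  also have "\<dots> = real F1 * F2 / q + 2 * real F2 / l + real F1 * l / q + 2" using lpos q by (simp add: field_simps)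
  finally show ?thesis .
qed

lemma card_lattice_pts_period:
  assumes "q > 0"
  shows "card (lattice_pts q t {0<..q} B) = card B"
proof -
  \<comment> \<open>The representative is taken in \<open>1..q\<close> instead of
    \<open>0..q - 1\<close>, to match the half-open period \<open>{0<..q}\<close>.\<close>
  define f where "f = (\<lambda>v. (t * v - 1) mod q + 1)"
  have "[f v = (t * v - 1) + 1] (mod q)" for v
    unfolding f_def by (intro cong_add cong_refl) (simp add: cong_def)
  hence f: "[f v = t * v] (mod q)" for v by simp
  have fr: "0 < f v" "f v \<le> q" for v
    using pos_mod_bound[OF assms, of "t * v - 1"] pos_mod_sign[OF assms, of "t * v - 1"] unfolding f_def by linarith+
  have uniq: "u = f v" if "[u = t * v] (mod q)" "0 < u" "u \<le> q" for u v
  proof -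
    have "[u = f v] (mod q)" using that f[of v] by (meson cong_sym cong_trans)
    hence "q dvd u - f v" by (simp add: cong_iff_dvd_diff)
    moreover have "\<bar>u - f v\<bar> < q" using that fr[of v] by linarith
    ultimately show ?thesis by (metis dvd_imp_le_int abs_of_pos[OF assms] eq_iff_diff_eq_0 not_le)
  qed
  have "bij_betw snd (lattice_pts q t {0<..q} B) B"
    by (rule bij_betw_byWitness[of _ "\<lambda>v. (f v, v)"]) (use uniq f fr in \<open>auto simp: lattice_pts_def\<close>)
  thus ?thesis by (rule bij_betw_same_card)
qed

text \<open>The lower bound applies the upper bound to the complementary columns of a full period, in
  which every row has exactly one lattice point.\<close>

lemma card_lattice_pts_ge:
  assumes q: "q > 0" and u0: "[u0 = t * int l] (mod q)" "\<bar>u0\<bar> \<le> int l" and l: "l = lattice_min q t"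
    and F1: "int F1 \<le> q"
  shows "card (lattice_pts q t {0<..int F1} {0<..int F2}) \<ge> real F1 * F2 / q - 2 * real F2 / l - real F1 * l / q"
proof -
  have lpos: "l > 0" using lattice_min_pos[OF q] l by simp
  \<comment> \<open>Only whole strips are kept. Each costs at most 2 through the bound for its
    complement, and dropping the incomplete strip lowers the main term by at most
    \<open>F1 * l / q\<close>.\<close>
  define N where "N = F2 div l"
  define R where "R = {0<..int (N * l)}"
  define F' where "F' = nat (q - int F1)"
  have F': "int F1 + int F' = q" using F1 by (simp add: F'_def)
  have Nl: "N * l \<le> F2" by (simp add: N_def)
  have "lattice_pts q t {0<..q} R \<subseteq> lattice_pts q t {0<..int F1} R \<union> lattice_pts q t {int F1<..int F1 + int F'} R"
    by (auto simp: lattice_pts_def F')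
  hence "card (lattice_pts q t {0<..q} R) \<le> card (lattice_pts q t {0<..int F1} R \<union> lattice_pts q t {int F1<..int F1 + int F'} R)"
    by (intro card_mono finite_UnI finite_lattice_pts) (auto simp: R_def)
  also have "\<dots> \<le> card (lattice_pts q t {0<..int F1} R) + card (lattice_pts q t {int F1<..int F1 + int F'} R)"
    by (rule card_Un_le)
  finally have 1: "N * l \<le> card (lattice_pts q t {0<..int F1} R) + card (lattice_pts q t {int F1<..int F1 + int F'} R)"
    unfolding card_lattice_pts_period[OF q] by (simp only: R_def card_greaterThanAtMost_int diff_0_right nat_int)
  have 2: "card (lattice_pts q t {0<..int F1} R) \<le> card (lattice_pts q t {0<..int F1} {0<..int F2})"
    using Nl by (intro card_mono finite_lattice_pts) (fastforce simp: lattice_pts_def R_def simp del: of_nat_mult)+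
  have 3: "card (lattice_pts q t {int F1<..int F1 + int F'} R) \<le> N * (real F' * l / q + 2)"
    unfolding R_def by (rule card_lattice_pts_blocks_le[OF q u0 l])
  have F'r: "real F' = q - F1" using F' by linarith
  have "real N * l \<le> card (lattice_pts q t {0<..int F1} {0<..int F2}) + N * (real F' * l / q + 2)"
  proof -
    have "real (N * l) \<le> real (card (lattice_pts q t {0<..int F1} R)) + real (card (lattice_pts q t {int F1<..int F1 + int F'} R))"
      using 1 by linarith
    thus ?thesis using 2 3 by simp
  qed
  hence "card (lattice_pts q t {0<..int F1} {0<..int F2}) \<ge> real N * l * F1 / q - 2 * N"
    using q by (simp add: F'r field_simps)
  moreover have "real N * l * F1 / q \<ge> (real F2 - l) * F1 / q"
  proof (intro divide_right_mono mult_right_mono)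
    have "F2 \<le> N * l + l" using lpos dividend_less_times_div[of l F2] by (simp add: N_def algebra_simps)
    thus "real F2 - l \<le> real N * l" by (metis diff_le_eq of_nat_add of_nat_le_iff of_nat_mult)
  qed (use q in auto)
  moreover have "(real F2 - l) * F1 / q = real F1 * F2 / q - real F1 * l / q" by (simp add: algebra_simps diff_divide_distrib)
  moreover have "real N \<le> F2 / l"
    using Nl lpos by (simp add: field_simps flip: of_nat_mult)
  ultimately show ?thesis by simp
qed

text \<open>If \<open>l \<le> Y\<close>, the additive 2 is at most \<open>2 * Y / l\<close>, and
  with the other two error terms this gives 2 + 1 + 2 = 5. If \<open>l > Y\<close>, a point of the
  box would be a nonzero lattice vector below the minimum, so the box is empty and only the main
  term, at most \<open>Y * l / q\<close>, remains.\<close>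

lemma oriented_lattice_discrepancy:
  fixes Y :: real
  assumes q: "q > 0" and u0: "[u0 = t * int l] (mod q)" "\<bar>u0\<bar> \<le> int l" and l: "l = lattice_min q t"
    and F: "int F1 \<le> q" "F1 \<le> Y" "F2 \<le> Y"
  shows "\<bar>card (lattice_pts q t {0<..int F1} {0<..int F2}) - real F1 * F2 / q\<bar> \<le> 5 * Y / l"
proof -
  have lpos: "l > 0" using lattice_min_pos[OF q] l by simp
  have lq: "real l * l \<le> q" using lattice_min_square_le[OF q, of t] l
    by (metis of_int_le_iff of_int_of_nat_eq of_nat_mult power2_eq_square)
  have Y0: "Y \<ge> 0" using F by linarith
  have e1: "2 * real F2 / l \<le> 2 * Y / l" using F by (intro divide_right_mono) auto
  have lql: "real l / q \<le> 1 / l" using lq lpos q by (simp add: field_simps)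
  have "real F1 * l / q \<le> Y * (l / q)" using F q by (simp add: divide_right_mono mult_right_mono)
  also have "\<dots> \<le> Y * (1 / l)" using lql Y0 by (intro mult_left_mono) auto
  finally have e2: "real F1 * l / q \<le> Y / l" by simp
  show ?thesis
  proof (cases "real l \<le> Y")
    case True
    hence "2 \<le> 2 * Y / l" using lpos by (simp add: field_simps)
    thus ?thesis using card_lattice_pts_le[OF q u0 l, of F1 F2] card_lattice_pts_ge[OF q u0 l F(1), of F2] e1 e2
      unfolding abs_le_iff by linarith
  next
    case False
    have "lattice_pts q t {0<..int F1} {0<..int F2} = {}"
    proof (rule ccontr)
      assume "lattice_pts q t {0<..int F1} {0<..int F2} \<noteq> {}"
      then obtain u v where uv: "[u = t * v] (mod q)" "0 < u" "u \<le> int F1" "0 < v" "v \<le> int F2"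
        by (auto simp: lattice_pts_def)
      have "l \<le> max F1 F2" unfolding l by (rule lattice_min_le[OF uv(1)]) (use uv in auto)
      thus False using F False by (auto simp: max_def split: if_splits)
    qed
    moreover have "real F1 * F2 / q \<le> Y * (l / q)"
    proof -
      have "real F1 * F2 / q \<le> Y * l / q" using F False q Y0 by (intro divide_right_mono mult_mono) auto
      thus ?thesis by simp
    qed
    moreover have "Y * (l / q) \<le> Y * (1 / l)" using lql Y0 by (intro mult_left_mono) auto
    moreover have "Y / l \<le> 5 * Y / l" "real F1 * F2 / q \<ge> 0" using Y0 q by (auto intro!: divide_right_mono)
    ultimately show ?thesis by simp
  qed
qed

text \<open>Here \<open>D\<close> may exceed \<open>q\<close>, so this is no case of the two-sided
  estimate, whose lower half compares with one full period.\<close>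

lemma oriented_lattice_count_le:
  assumes q: "q > 0" and u0: "[u0 = t * int l] (mod q)" "\<bar>u0\<bar> \<le> int l" and l: "l = lattice_min q t"
  shows "card (lattice_pts q t {0<..int D} {0<..int D}) \<le> real D * D / q + 5 * real D / l"
proof (cases "l \<le> D")
  case True
  have lpos: "l > 0" using lattice_min_pos[OF q] l by simp
  have lq: "real l * l \<le> q" using lattice_min_square_le[OF q, of t] l
    by (metis of_int_le_iff of_int_of_nat_eq of_nat_mult power2_eq_square)
  have lql: "real l / q \<le> 1 / l" using lq lpos q by (simp add: field_simps)
  have "D * (l / q) \<le> D * (1 / l)" using lql by (intro mult_left_mono) auto
  hence "real D * l / q \<le> D / l" by simp
  moreover have "2 \<le> 2 * real D / l" using True lpos by (simp add: field_simps)
  moreover have "5 * real D / l = 2 * real D / l + D / l + 2 * real D / l" by (simp add: field_simps)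
  ultimately show ?thesis using card_lattice_pts_le[OF assms, of D D] by linarith
next
  case False
  have "lattice_pts q t {0<..int D} {0<..int D} = {}"
  proof (rule ccontr)
    assume "lattice_pts q t {0<..int D} {0<..int D} \<noteq> {}"
    then obtain u v where uv: "[u = t * v] (mod q)" "0 < u" "u \<le> int D" "0 < v" "v \<le> int D"
      by (auto simp: lattice_pts_def)
    have "l \<le> D" unfolding l by (rule lattice_min_le[OF uv(1)]) (use uv in auto)
    thus False using False by simp
  qed
  thus ?thesis using q by simp
qed

text \<open>Strips need a shortest vector whose second coordinate equals the minimum. A change of
  sign makes the extremal coordinate positive; if it is the first one, exchanging the coordinates
  replaces \<open>t\<close> by its inverse.\<close>

lemma lattice_orientation:
  assumes q: "q > 0" and inv: "[t * t' = 1] (mod q)"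
  obtains u0 where "[u0 = t * int (lattice_min q t)] (mod q)" "\<bar>u0\<bar> \<le> int (lattice_min q t)"
  | u0 where "[u0 = t' * int (lattice_min q t)] (mod q)" "\<bar>u0\<bar> \<le> int (lattice_min q t)"
proof -
  obtain u v where uv: "\<bar>u\<bar> \<le> int (lattice_min q t)" "\<bar>v\<bar> \<le> int (lattice_min q t)" "[u = t * v] (mod q)"
    "\<bar>u\<bar> = int (lattice_min q t) \<or> \<bar>v\<bar> = int (lattice_min q t)"
    using lattice_min_witness[OF q, of t] by metis
  have vu: "[v = t' * u] (mod q)" using uv(3) lattice_swap_cong[OF inv] by blast
  have neg: "[- u = t * (- v)] (mod q)" "[- v = t' * (- u)] (mod q)"
    using uv(3) vu by (simp_all add: cong_minus_minus_iff)
  consider "v = int (lattice_min q t)" | "- v = int (lattice_min q t)" | "u = int (lattice_min q t)" | "- u = int (lattice_min q t)"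
    using uv(4) by linarith
  thus ?thesis
  proof cases
    case 1 thus ?thesis using that(1)[of u] uv by metis
  next
    case 2 thus ?thesis using that(1)[of "-u"] uv neg(1) by (metis abs_minus_cancel)
  next
    case 3 thus ?thesis using that(2)[of v] uv vu by metis
  next
    case 4 thus ?thesis using that(2)[of "-v"] uv neg(2) by (metis abs_minus_cancel)
  qed
qed

lemma lattice_discrepancy:
  fixes Y :: real
  assumes q: "q > 0" and t: "coprime t q"
    and F: "int F1 \<le> q" "int F2 \<le> q" "F1 \<le> Y" "F2 \<le> Y"
  shows "\<bar>card (lattice_pts q t {0<..int F1} {0<..int F2}) - real F1 * F2 / q\<bar> \<le> 5 * Y / lattice_min q t"
proof -
  obtain t' where inv: "[t * t' = 1] (mod q)" using cong_solve_coprime_int[OF t] by blast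
  show ?thesis
  proof (rule lattice_orientation[OF q inv])
    fix u0 assume "[u0 = t * int (lattice_min q t)] (mod q)" "\<bar>u0\<bar> \<le> int (lattice_min q t)"
    thus ?thesis using oriented_lattice_discrepancy[OF q _ _ refl F(1,3,4)] by blast
  next
    fix u0 assume "[u0 = t' * int (lattice_min q t)] (mod q)" "\<bar>u0\<bar> \<le> int (lattice_min q t)"
    hence "\<bar>card (lattice_pts q t' {0<..int F2} {0<..int F1}) - real F2 * F1 / q\<bar> \<le> 5 * Y / lattice_min q t"
      using oriented_lattice_discrepancy[OF q _ _ lattice_min_inverse[OF inv, symmetric] F(2,4,3)] by blast
    thus ?thesis by (simp add: card_lattice_pts_swap[OF inv] mult.commute)
  qed
qed

lemma lattice_count_le:
  assumes q: "q > 0" and t: "coprime t q"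
  shows "card (lattice_pts q t {0<..int D} {0<..int D}) \<le> real D * D / q + 5 * real D / lattice_min q t"
proof -
  obtain t' where inv: "[t * t' = 1] (mod q)" using cong_solve_coprime_int[OF t] by blast
  show ?thesis
  proof (rule lattice_orientation[OF q inv])
    fix u0 assume "[u0 = t * int (lattice_min q t)] (mod q)" "\<bar>u0\<bar> \<le> int (lattice_min q t)"
    thus ?thesis using oriented_lattice_count_le[OF q _ _ refl] by blast
  next
    fix u0 assume "[u0 = t' * int (lattice_min q t)] (mod q)" "\<bar>u0\<bar> \<le> int (lattice_min q t)"
    hence "card (lattice_pts q t' {0<..int D} {0<..int D}) \<le> real D * D / q + 5 * real D / lattice_min q t"
      using oriented_lattice_count_le[OF q _ _ lattice_min_inverse[OF inv, symmetric]] by blast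
    thus ?thesis by (simp add: card_lattice_pts_swap[OF inv])
  qed
qed

section \<open>The distribution of short vectors\<close>

text \<open>From \<open>int t * int l = u + q * k\<close> with \<open>|u| \<le> l\<close>, the
  number \<open>t\<close> lies within 1 of \<open>k * q / l\<close>, hence among three integers
  around the floor \<open>c k\<close>. The range of \<open>t\<close> leaves \<open>l + 3\<close>
  values of \<open>k\<close>, and \<open>3 * (l + 3) \<le> 12 * l\<close>.\<close>

lemma card_small_residue_multiples:
  fixes q :: int and l :: nat
  assumes "q > 0" "l > 0" "int l \<le> q"
  defines "S \<equiv> {t::nat. int t \<le> q \<and> (\<exists>u. \<bar>u\<bar> \<le> int l \<and> [u = int t * int l] (mod q))}"
  shows "finite S" "card S \<le> 12 * l"
proof -
  define c where "c = (\<lambda>k. (k * q) div int l)"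
  have sub: "S \<subseteq> (\<Union>k\<in>{-1..int l + 1}. nat ` {c k - 1..c k + 1})"
  proof
    fix t assume "t \<in> S"
    then obtain u where u: "int t \<le> q" "\<bar>u\<bar> \<le> int l" "[int t * int l = u] (mod q)"
      by (auto simp: S_def cong_sym_eq)
    then obtain k where k: "int t * int l - u = q * k" by (auto simp: cong_iff_dvd_diff)
    have "int t * int l \<le> q * int l" using u(1) by (intro mult_right_mono) auto
    hence "q * k \<le> q * int l + q * 1" using k u(2) assms(3) by linarith
    hence "q * k \<le> q * (int l + 1)" by (simp add: algebra_simps)
    hence k1: "k \<le> int l + 1" using assms(1) by simp
    have "0 \<le> int t * int l" by simp
    hence "q * (-1) \<le> q * k" using k u(2) assms(3) by linarith
    hence k2: "-1 \<le> k" using assms(1) by (simp only: mult_le_cancel_left_pos)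
    have c1: "c k * int l \<le> k * q" "k * q < c k * int l + int l"
      using assms(2) pos_mod_bound[of "int l" "k * q"] pos_mod_sign[of "int l" "k * q"]
        div_mult_mod_eq[of "k * q" "int l"] unfolding c_def by linarith+
    have "int t * int l \<ge> (c k - 1) * int l"
    proof -
      have "(c k - 1) * int l = c k * int l - int l" by (simp add: algebra_simps)
      also have "\<dots> \<le> q * k + u" using c1 u(2) by (auto simp: mult.commute)
      finally show ?thesis using k by linarith
    qed
    hence t1: "c k - 1 \<le> int t" using assms(2) by simp
    have "int t * int l < (c k + 2) * int l"
    proof -
      have "int t * int l \<le> k * q + int l" using u(2) k by (auto simp: mult.commute)
      also have "\<dots> < c k * int l + int l + int l" using c1 by linarith
      finally show ?thesis by (simp add: algebra_simps)
    qed
    hence t2: "int t \<le> c k + 1" using assms(2) by simp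
    have "t = nat (int t)" by simp
    thus "t \<in> (\<Union>k\<in>{-1..int l + 1}. nat ` {c k - 1..c k + 1})" using k1 k2 t1 t2
      by (intro UN_I[of k] image_eqI[of _ _ "int t"]) auto
  qed
  show fin: "finite S" by (rule finite_subset[OF sub]) auto
  have "card S \<le> card (\<Union>k\<in>{-1..int l + 1}. nat ` {c k - 1..c k + 1})" using sub by (intro card_mono) auto
  also have "\<dots> \<le> (\<Sum>k\<in>{-1..int l + 1}. card (nat ` {c k - 1..c k + 1}))" by (intro card_UN_le) auto
  also have "\<dots> \<le> (\<Sum>k\<in>{-1..int l + 1}. 3)"
  proof (intro sum_mono)
    fix k show "card (nat ` {c k - 1..c k + 1}) \<le> 3"
      using card_image_le[of "{c k - 1..c k + 1}" nat] by simp
  qed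
  also have "\<dots> \<le> 12 * l" using assms(2) by simp
  finally show "card S \<le> 12 * l" .
qed

lemma totatives_representative:
  fixes q :: nat and a :: int
  assumes "q > 0" "coprime a (int q)"
  obtains t where "t \<in> totatives q" "[a = int t] (mod int q)"
proof (cases "q = 1")
  \<comment> \<open>\<open>totatives 1\<close> is \<open>{1}\<close>, whereas reduction modulo 1
    would return 0.\<close>
  case True thus ?thesis using that[of 1] by auto
next
  case False
  have c: "[a = int (nat (a mod int q))] (mod int q)" using assms(1) by (simp add: cong_def)
  hence "coprime (int (nat (a mod int q))) (int q)" using assms(2) cong_imp_coprime by blast
  hence "coprime (nat (a mod int q)) q" by (simp only: coprime_int_iff)
  moreover have "nat (a mod int q) < q" using assms(1) by (simp add: nat_less_iff)
  moreover have "nat (a mod int q) > 0"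
  proof (rule ccontr)
    assume "\<not> nat (a mod int q) > 0"
    hence "coprime 0 q" using calculation(1) by simp
    thus False using False by simp
  qed
  ultimately show ?thesis using that[OF _ c] by (simp add: in_totatives_iff)
qed

lemma totatives_cong_eq:
  assumes "s \<in> totatives q" "t \<in> totatives q" "[int s = int t] (mod int q)"
  shows "s = t"
proof (cases "q = 1")
  case True thus ?thesis using assms by auto
next
  case False
  have "s < q" "t < q" using assms(1,2) False totatives_less[of _ q]
    by (metis One_nat_def Suc_lessI in_totatives_iff less_le_trans)+
  thus ?thesis using assms(3) by (simp add: cong_int_iff cong_less_modulus_unique_nat)
qed

text \<open>For a unit \<open>t\<close> with minimum \<open>l\<close>, either \<open>t\<close> or
  its inverse \<open>r t\<close> admits a lattice vector \<open>(u, l)\<close> with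
  \<open>|u| \<le> l\<close> and so lies in \<open>S\<close>. Inversion is injective on units, which
  doubles the bound \<open>12 * l\<close>.\<close>

lemma card_lattice_min_eq_le:
  fixes q l :: nat
  assumes "q > 0" "l > 0"
  shows "card {t \<in> totatives q. lattice_min (int q) (int t) = l} \<le> 24 * l"
proof (cases "l \<le> q")
  case False
  have "lattice_min (int q) (int t) \<noteq> l" for t
  proof
    assume "lattice_min (int q) (int t) = l"
    hence "int l ^ 2 \<le> int q" using lattice_min_square_le[of "int q" "int t"] assms by simp
    hence "l ^ 2 \<le> q" by (metis of_nat_le_iff of_nat_power)
    moreover have "l \<le> l ^ 2" by (simp add: power2_eq_square)
    ultimately show False using False by simp
  qed
  thus ?thesis by simp
next
  case True
  define S where "S = {t::nat. int t \<le> int q \<and> (\<exists>u. \<bar>u\<bar> \<le> int l \<and> [u = int t * int l] (mod int q))}"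
  have S: "finite S" "card S \<le> 12 * l"
    unfolding S_def using card_small_residue_multiples[of "int q" l] assms True by auto
  define T where "T = {t \<in> totatives q. lattice_min (int q) (int t) = l}"
  have "\<exists>t'\<in>totatives q. [int t * int t' = 1] (mod int q)" if "t \<in> totatives q" for t
  proof -
    have "coprime (int t) (int q)" using that by (simp add: in_totatives_iff)
    then obtain a where a: "[int t * a = 1] (mod int q)" using cong_solve_coprime_int by blast
    hence "coprime a (int q)" by (metis coprime_iff_invertible_int mult.commute)
    then obtain t' where t': "t' \<in> totatives q" "[a = int t'] (mod int q)"
      using totatives_representative[OF assms(1)] by metis
    have "[int t * int t' = int t * a] (mod int q)" using t'(2) by (intro cong_mult cong_refl) (simp add: cong_sym)
    thus ?thesis using a t' cong_trans by blast
  qed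
  then obtain r where r: "\<And>t. t \<in> totatives q \<Longrightarrow> r t \<in> totatives q \<and> [int t * int (r t) = 1] (mod int q)" by metis
  have "inj_on r T"
  proof (rule inj_onI)
    fix s t assume *: "s \<in> T" "t \<in> T" "r s = r t"
    have "s \<in> totatives q" "t \<in> totatives q" using * by (auto simp: T_def)
    hence "[int s * int (r s) = int t * int (r s)] (mod int q)" "coprime (int (r s)) (int q)"
      using r[of s] r[of t] *(3) by (auto simp: in_totatives_iff intro: cong_trans[OF _ cong_sym])
    hence "[int s = int t] (mod int q)" using cong_mult_rcancel by blast
    thus "s = t" using * totatives_cong_eq by (auto simp: T_def)
  qed
  have mem: "t \<in> S \<or> r t \<in> S" if "t \<in> T" for t
  proof -
    have t: "t \<in> totatives q" "lattice_min (int q) (int t) = l" using that by (auto simp: T_def)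
    have inv: "[int t * int (r t) = 1] (mod int q)" using r t by blast
    have le: "t \<le> q" "r t \<le> q" using t r[of t] by (auto simp: in_totatives_iff)
    show ?thesis
      by (rule lattice_orientation[OF _ inv]) (use assms t le in \<open>auto simp: S_def\<close>)
  qed
  have "T \<subseteq> (S \<inter> T) \<union> {t \<in> T. r t \<in> S}" using mem by auto
  moreover have finT: "finite T" by (simp add: T_def)
  ultimately have "card T \<le> card (S \<inter> T) + card {t \<in> T. r t \<in> S}"
    using card_Un_le[of "S \<inter> T" "{t \<in> T. r t \<in> S}"] card_mono[of "S \<inter> T \<union> {t \<in> T. r t \<in> S}" T] S(1)
    by simp
  also have "card (S \<inter> T) \<le> card S" using S by (intro card_mono) auto
  also have "card {t \<in> T. r t \<in> S} \<le> card S"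
    using \<open>inj_on r T\<close> S by (intro card_inj_on_le[of r]) (auto intro: inj_on_subset)
  finally show ?thesis using S(2) unfolding T_def by simp
qed

text \<open>Grouping by the value \<open>l\<close> of the minimum leaves at most
  \<open>24 * l / l^2\<close> for each \<open>l \<le> q\<close>, a harmonic sum.\<close>

lemma sum_inverse_lattice_min_square_le:
  fixes q :: nat
  assumes "q > 0"
  shows "(\<Sum>t\<in>totatives q. 1 / (real (lattice_min (int q) (int t)))\<^sup>2) \<le> 24 * (1 + ln q)"
proof -
  define m where "m = (\<lambda>t::nat. lattice_min (int q) (int t))"
  have m: "m t \<in> {1..q}" for t
  proof -
    have "m t ^ 2 \<le> q" unfolding m_def using lattice_min_square_le[of "int q" "int t"] assms by linarith
    moreover have "m t \<le> m t ^ 2" by (simp add: power2_eq_square)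
    moreover have "m t > 0" using lattice_min_pos[of "int q"] assms by (simp add: m_def)
    ultimately show ?thesis by simp
  qed
  have "(\<Sum>t\<in>totatives q. 1 / (real (m t))\<^sup>2) = (\<Sum>l\<in>{1..q}. \<Sum>t\<in>{t \<in> totatives q. m t = l}. 1 / (real (m t))\<^sup>2)"
    using m by (intro sum.group[symmetric]) auto
  also have "\<dots> = (\<Sum>l\<in>{1..q}. card {t \<in> totatives q. m t = l} / (real l)\<^sup>2)" by (intro sum.cong) auto
  also have "\<dots> \<le> (\<Sum>l\<in>{1..q}. 24 * inverse (real l))"
  proof (rule sum_mono)
    fix l assume l: "l \<in> {1..q}"
    have "real (card {t \<in> totatives q. m t = l}) \<le> 24 * real l"
      using card_lattice_min_eq_le[OF assms, of l] l unfolding m_def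
      by (metis One_nat_def Suc_le_lessD atLeastAtMost_iff of_nat_le_iff of_nat_mult of_nat_numeral)
    thus "card {t \<in> totatives q. m t = l} / (real l)\<^sup>2 \<le> 24 * inverse (real l)"
      using l by (simp add: field_simps power2_eq_square)
  qed
  also have "\<dots> = 24 * harm q" by (simp add: harm_def sum_distrib_left)
  also have "harm q \<le> 1 + ln (real q)"
    using euler_mascheroni_sequence_decreasing[of 1 q] assms by (simp add: harm_def)
  finally show ?thesis by (simp add: m_def distrib_left)
qed

text \<open>A square root $s$ of $s_0^2$ modulo $q$ is determined up to two choices by $\gcd(s - s_0, q)$:
  the complementary divisor of $q$ divides $s + s_0$, and the two divisors have at most the factor
  2 in common.\<close>

lemma card_square_roots_le:
  fixes q :: nat and a :: int
  assumes "q > 0"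
  shows "card {s \<in> totatives q. [(int s)\<^sup>2 = a] (mod int q)} \<le> 2 * card {d. d dvd q}"
proof -
  define S where "S = {s \<in> totatives q. [(int s)\<^sup>2 = a] (mod int q)}"
  have finS: "finite S" by (simp add: S_def)
  show ?thesis
  proof (cases "S = {}")
    case True thus ?thesis unfolding S_def[symmetric] by simp
  next
    case False
    then obtain s0 where s0: "s0 \<in> S" by blast
    define g where "g = (\<lambda>s::nat. nat (gcd (int s - int s0) (int q)))"
    have gdvd: "g s dvd q" for s
    proof -
      have "int (g s) dvd int q" by (simp add: g_def)
      thus ?thesis by simp
    qed
    have key: "int q dvd 2 * (int s - int s')" if "s \<in> S" "s' \<in> S" "g s = g s'" for s s'
    proof -
      define G where "G = int (g s)"
      have G: "G = gcd (int s - int s0) (int q)" "G = gcd (int s' - int s0) (int q)"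
        using that(3) unfolding G_def g_def by (metis gcd_ge_0_int int_nat_eq)+
      obtain H where H: "int q = G * H" using gdvd[of s] unfolding G_def by (metis dvdE of_nat_mult)
      have Gpos: "G > 0" using G(1) assms by (simp add: gcd_pos_int)
      have Hd: "H dvd int r + int s0" if r: "r \<in> S" "G = gcd (int r - int s0) (int q)" for r
      proof -
        have "[(int r)\<^sup>2 = (int s0)\<^sup>2] (mod int q)" using r s0 unfolding S_def by (metis (mono_tags, lifting) cong_sym cong_trans mem_Collect_eq)
        hence "int q dvd (int r - int s0) * (int r + int s0)"
          by (simp add: cong_iff_dvd_diff power2_eq_square algebra_simps)
        moreover obtain k where k: "int r - int s0 = G * k" using r(2) by (metis dvdE gcd_dvd1)
        ultimately have "G * H dvd G * (k * (int r + int s0))" by (simp add: H mult.assoc)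
        hence *: "H dvd k * (int r + int s0)" using Gpos by simp
        \<comment> \<open>Since \<open>G\<close> is the full gcd of \<open>G * k\<close> with
          \<open>q = G * H\<close>, the cofactor \<open>k\<close> is coprime to \<open>H\<close>;
          this forces \<open>H\<close> to divide the other factor \<open>r + s0\<close>.\<close>
        have "G = G * gcd k H" using r(2) Gpos unfolding k H by (simp add: gcd_mult_distrib_int[symmetric])
        hence "gcd k H = 1" using Gpos by simp
        hence "coprime H k" by (simp add: coprime_iff_gcd_eq_1 gcd.commute)
        thus ?thesis using * by (simp add: coprime_dvd_mult_right_iff)
      qed
      have g1: "G dvd int s - int s'"
      proof -
        have "G dvd (int s - int s0) - (int s' - int s0)" using G by (metis dvd_diff gcd_dvd1)
        thus ?thesis by simp
      qed
      have h1: "H dvd int s - int s'"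
      proof -
        have "H dvd (int s + int s0) - (int s' + int s0)" using Hd that G by (blast intro: dvd_diff)
        thus ?thesis by simp
      qed
      have "coprime (gcd G H) (int s0)"
      proof -
        have "coprime (int s0) (int q)" using s0 by (simp add: S_def in_totatives_iff)
        thus ?thesis using H by (metis coprime_commute coprime_divisors dvd_refl dvd_triv_left gcd_dvd1 dvd_trans)
      qed
      moreover have "gcd G H dvd 2 * int s0"
      proof -
        have "gcd G H dvd int s - int s0" using G(1) by (metis gcd_dvd1 dvd_trans)
        moreover have "gcd G H dvd int s + int s0" using Hd[OF that(1) G(1)] by (meson gcd_dvd2 dvd_trans)
        ultimately have "gcd G H dvd (int s + int s0) - (int s - int s0)" by (rule dvd_diff[rotated])
        thus ?thesis by simp
      qed
      ultimately have "gcd G H dvd 2" by (simp add: coprime_dvd_mult_left_iff)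
      \<comment> \<open>Both \<open>G\<close> and \<open>H\<close> divide the difference; the factor
        \<open>gcd G H\<close> makes up for what they share.\<close>
      moreover have "G * H dvd gcd G H * (int s - int s')"
      proof -
        have "G * H dvd G * (int s - int s')" "G * H dvd H * (int s - int s')"
          using g1 h1 by (simp_all add: mult_dvd_mono mult.commute[of G H])
        hence "G * H dvd gcd (G * (int s - int s')) (H * (int s - int s'))" by simp
        also have "gcd (G * (int s - int s')) (H * (int s - int s')) dvd gcd G H * (int s - int s')"
          by (simp add: gcd_mult_right gcd.commute)
        finally show ?thesis .
      qed
      ultimately show ?thesis using H by (metis dvd_refl dvd_trans mult_dvd_mono)
    qed
    have fib: "card {s \<in> S. g s = d} \<le> 2" for d
    proof (cases "{s \<in> S. g s = d} = {}")
      case False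
      define s1 where "s1 = Min {s \<in> S. g s = d}"
      have s1: "s1 \<in> S" "g s1 = d" using Min_in[OF _ False] finS by (auto simp: s1_def)
      \<comment> \<open>For the least root \<open>s1\<close> of the fibre, \<open>q\<close> divides
        \<open>2 * (s - s1)\<close>, which is below \<open>2 * q\<close>. So \<open>s - s1\<close>
        is 0 or half of \<open>q\<close>.\<close>
      have "{s \<in> S. g s = d} \<subseteq> (\<lambda>j. s1 + j * q div 2) ` {0, 1}"
      proof
        fix s assume s: "s \<in> {s \<in> S. g s = d}"
        have ge: "s1 \<le> s" unfolding s1_def using s finS by (intro Min_le) auto
        have "int q dvd 2 * (int s - int s1)" using key[of s s1] s s1 by auto
        hence "int q dvd int (2 * (s - s1))" using ge by (simp add: of_nat_diff)
        hence "q dvd 2 * (s - s1)" by (simp only: int_dvd_int_iff)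
        then obtain j where j: "2 * (s - s1) = q * j" by blast
        have "s \<le> q" "s1 > 0" using s s1 by (auto simp: S_def in_totatives_iff)
        hence "s - s1 < q" using assms by linarith
        hence "q * j < q * 2" using j by linarith
        hence "j < 2" by simp
        hence "j = 0 \<or> j = 1" by auto
        moreover have "s = s1 + j * q div 2" using j ge by (simp add: mult.commute)
        ultimately show "s \<in> (\<lambda>j. s1 + j * q div 2) ` {0, 1}" by blast
      qed
      hence "card {s \<in> S. g s = d} \<le> card ((\<lambda>j. s1 + j * q div 2) ` {0, 1})" by (intro card_mono) auto
      also have "\<dots> \<le> card {0::nat, 1}" by (intro card_image_le) auto
      finally show ?thesis by simp
    next
      case True thus ?thesis by (simp only: card.empty)
    qed
    have "card S = (\<Sum>d\<in>{d. d dvd q}. card {s \<in> S. g s = d})"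
    proof -
      have "g ` S \<subseteq> {d. d dvd q}" using gdvd by auto
      thus ?thesis using sum.group[OF finS, of "{d. d dvd q}" g "\<lambda>_. 1::nat"] assms by simp
    qed
    also have "\<dots> \<le> (\<Sum>d\<in>{d. d dvd q}. 2)" by (intro sum_mono fib)
    finally show ?thesis by (simp add: S_def)
  qed
qed

text \<open>Each square is replaced by its representative \<open>t\<close> among the totatives,
  which has the same minimum; after exchanging the sums, \<open>t\<close> is counted once per square
  root.\<close>

lemma sum_inverse_lattice_min_of_square_le:
  fixes q :: nat
  assumes "q > 0"
  shows "(\<Sum>s\<in>totatives q. 1 / (real (lattice_min (int q) ((int s)\<^sup>2)))\<^sup>2)
           \<le> 2 * card {d. d dvd q} * (\<Sum>t\<in>totatives q. 1 / (real (lattice_min (int q) (int t)))\<^sup>2)"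
proof -
  define w where "w = (\<lambda>a. 1 / (real (lattice_min (int q) a))\<^sup>2)"
  define P where "P = (\<lambda>s t::nat. [(int s)\<^sup>2 = int t] (mod int q))"
  have w0: "w a \<ge> 0" for a by (simp add: w_def)
  have "(\<Sum>s\<in>totatives q. w ((int s)\<^sup>2)) \<le> (\<Sum>s\<in>totatives q. \<Sum>t\<in>totatives q. if P s t then w (int t) else 0)"
  proof (rule sum_mono)
    fix s assume s: "s \<in> totatives q"
    have "coprime ((int s)\<^sup>2) (int q)" using s by (simp add: in_totatives_iff)
    then obtain t where t: "t \<in> totatives q" "[(int s)\<^sup>2 = int t] (mod int q)"
      using totatives_representative[OF assms] by metis
    have "w ((int s)\<^sup>2) = (if P s t then w (int t) else 0)"
      using t(2) lattice_min_cong[OF t(2)] by (simp add: w_def P_def)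
    also have "\<dots> \<le> (\<Sum>t\<in>totatives q. if P s t then w (int t) else 0)"
      using t w0 by (intro member_le_sum) auto
    finally show "w ((int s)\<^sup>2) \<le> (\<Sum>t\<in>totatives q. if P s t then w (int t) else 0)" .
  qed
  also have "\<dots> = (\<Sum>t\<in>totatives q. \<Sum>s\<in>totatives q. if P s t then w (int t) else 0)" by (rule sum.swap)
  also have "\<dots> = (\<Sum>t\<in>totatives q. card {s \<in> totatives q. P s t} * w (int t))"
    by (intro sum.cong refl) (simp add: sum.If_cases Int_def)
  also have "\<dots> \<le> (\<Sum>t\<in>totatives q. (2 * card {d. d dvd q}) * w (int t))"
  proof (intro sum_mono mult_right_mono w0)
    fix t show "real (card {s \<in> totatives q. P s t}) \<le> real (2 * card {d. d dvd q})"
      unfolding P_def of_nat_le_iff by (rule card_square_roots_le[OF assms])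
  qed
  also have "\<dots> = 2 * card {d. d dvd q} * (\<Sum>t\<in>totatives q. w (int t))" by (simp add: sum_distrib_left)
  finally show ?thesis by (simp add: w_def)
qed

section \<open>Divisors and the Moebius function\<close>

lemma card_divisors_prime_power_mult_le:
  fixes p a m :: nat
  assumes "prime p" "m > 0"
  shows "card {d. d dvd p ^ a * m} \<le> (a + 1) * card {d. d dvd m}"
proof -
  have "{d. d dvd p ^ a * m} \<subseteq> (\<lambda>(i, e). p ^ i * e) ` ({0..a} \<times> {d. d dvd m})"
  proof
    fix d assume "d \<in> {d. d dvd p ^ a * m}"
    then obtain b c where bc: "d = b * c" "b dvd p ^ a" "c dvd m" using division_decomp by blast
    then obtain i where "i \<le> a" "b = p ^ i" using divides_primepow_nat[OF assms(1)] by auto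
    with bc show "d \<in> (\<lambda>(i, e). p ^ i * e) ` ({0..a} \<times> {d. d dvd m})" by auto
  qed
  hence "card {d. d dvd p ^ a * m} \<le> card ((\<lambda>(i, e). p ^ i * e) ` ({0..a} \<times> {d. d dvd m}))"
    using assms by (intro card_mono finite_imageI finite_cartesian_product) auto
  also have "\<dots> \<le> card ({0..a} \<times> {d. d dvd m})"
    using assms by (intro card_image_le finite_cartesian_product) auto
  finally show ?thesis by (simp add: card_cartesian_product)
qed

text \<open>The quotient of the divisor function by the power of \<open>n\<close> is a product of
  local factors \<open>(a + 1) / p powr (a * \<epsilon>)\<close>. Such a factor is at most 1 once
  \<open>p powr \<epsilon> \<ge> 2\<close>, by \<open>a + 1 \<le> 2 ^ a\<close>. At most
  \<open>K\<close> smaller primes remain, and each contributes at most \<open>B\<close>.\<close>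

lemma divisor_bound:
  fixes \<epsilon> :: real
  assumes "\<epsilon> > 0"
  obtains C where "C \<ge> 1" "\<And>n::nat. n > 0 \<Longrightarrow> real (card {d. d dvd n}) \<le> C * real n powr \<epsilon>"
proof -
  \<comment> \<open>Chosen so that \<open>B * (1 + a * \<epsilon> * ln 2)\<close> is at least
    \<open>a + 1\<close>; the bracket is below \<open>p powr (a * \<epsilon>)\<close> by
    \<open>1 + y \<le> exp y\<close>.\<close>
  define B where "B = 1 / (\<epsilon> * ln 2) + 1"
  define K where "K = nat \<lceil>2 powr (1 / \<epsilon>)\<rceil>"
  define small where "small = (\<lambda>n. {p \<in> prime_factors n. p < K})"
  have B1: "B \<ge> 1" using assms by (simp add: B_def)
  have local_bound: "real (a + 1) \<le> (if p < K then B else 1) * real (p ^ a) powr \<epsilon>" if "prime p" for p a :: nat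
  proof -
    have p2: "p \<ge> 2" using that by (rule prime_ge_2_nat)
    have pa: "real (p ^ a) powr \<epsilon> = exp (real a * (\<epsilon> * ln p))"
      using p2 by (simp add: powr_def ln_realpow algebra_simps)
    show ?thesis
    proof (cases "p < K")
      case True
      have "real a * (\<epsilon> * ln 2) \<le> real a * (\<epsilon> * ln p)"
        using p2 assms by (intro mult_left_mono) auto
      moreover have "1 + real a * (\<epsilon> * ln p) \<le> exp (real a * (\<epsilon> * ln p))" by (rule exp_ge_add_one_self)
      ultimately have "1 + real a * (\<epsilon> * ln 2) \<le> real (p ^ a) powr \<epsilon>" unfolding pa by linarith
      hence "B * (1 + real a * (\<epsilon> * ln 2)) \<le> B * real (p ^ a) powr \<epsilon>" using B1 by (intro mult_left_mono) auto
      moreover have "B * (1 + real a * (\<epsilon> * ln 2)) = (real a + 1) + (1 / (\<epsilon> * ln 2) + real a * (\<epsilon> * ln 2))"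
        using assms by (simp add: B_def field_simps)
      moreover have "1 / (\<epsilon> * ln 2) + real a * (\<epsilon> * ln 2) \<ge> 0"
        using assms by (intro add_nonneg_nonneg mult_nonneg_nonneg divide_nonneg_nonneg) auto
      ultimately show ?thesis using True by simp
    next
      case False
      have "2 powr (1 / \<epsilon>) \<le> real p" using False unfolding K_def by linarith
      hence "(2 powr (1 / \<epsilon>)) powr \<epsilon> \<le> real p powr \<epsilon>" using assms by (intro powr_mono2) auto
      hence p: "2 \<le> real p powr \<epsilon>" using assms by (simp add: powr_powr)
      have "real (a + 1) \<le> 2 ^ a"
      proof -
        have "a + 1 \<le> 2 ^ a" by (induction a) auto
        thus ?thesis by (metis of_nat_le_iff of_nat_numeral of_nat_power)
      qed
      also have "\<dots> \<le> (real p powr \<epsilon>) ^ a" using p by (intro power_mono) auto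
      also have "\<dots> = real (p ^ a) powr \<epsilon>" using p2 by (simp add: powr_realpow[symmetric] powr_powr mult.commute powr_power)
      finally show ?thesis using False by simp
    qed
  qed
  \<comment> \<open>Counting the small primes of \<open>n\<close> in the exponent makes the
    induction exact: splitting off a whole prime power changes the exponent by 1 if that prime is
    small and by 0 otherwise.\<close>
  have main: "real (card {d. d dvd n}) \<le> B ^ card (small n) * real n powr \<epsilon>" if "n > 0" for n
    using that
  proof (induction n rule: less_induct)
    case (less n)
    show ?case
    proof (cases "n = 1")
      case True thus ?thesis by (simp add: small_def)
    next
      case False
      then obtain p where p: "prime p" "p dvd n" using prime_factor_nat by blast
      define a where "a = multiplicity p n"
      obtain m where m: "n = p ^ a * m" "\<not> p dvd m"
        using multiplicity_decompose'[of n p] less.prems p(1) unfolding a_def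
        by (metis not_prime_unit not_gr_zero)
      have m0: "m > 0" using m less.prems by (cases m) auto
      have a0: "a > 0" using p less.prems unfolding a_def by (simp add: prime_multiplicity_gt_zero_iff)
      have "m < n" using m(1) m0 one_less_power[OF prime_gt_1_nat[OF p(1)] a0] by simp
      note IH = less.IH[OF this m0]
      have pf: "prime_factors n = insert p (prime_factors m)"
        using m m0 a0 p(1) by (simp add: prime_factors_product prime_power_iff prime_factors_power prime_prime_factors)
      have pm: "p \<notin> prime_factors m" using m(2) by auto
      have sm: "B ^ card (small n) = (if p < K then B else 1) * B ^ card (small m)"
      proof -
        have "small n = (if p < K then insert p (small m) else small m)" by (auto simp: small_def pf)
        thus ?thesis using pm by (simp add: small_def)
      qed
      have "real (card {d. d dvd n}) \<le> real (a + 1) * real (card {d. d dvd m})"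
        using card_divisors_prime_power_mult_le[OF p(1) m0, of a] m(1) by (metis of_nat_le_iff of_nat_mult)
      also have "\<dots> \<le> ((if p < K then B else 1) * real (p ^ a) powr \<epsilon>) * (B ^ card (small m) * real m powr \<epsilon>)"
        using local_bound[OF p(1), of a] IH B1 by (intro mult_mono) auto
      also have "\<dots> = B ^ card (small n) * (real (p ^ a) powr \<epsilon> * real m powr \<epsilon>)" by (simp add: sm)
      also have "real (p ^ a) powr \<epsilon> * real m powr \<epsilon> = real n powr \<epsilon>"
        by (simp add: m(1) powr_mult)
      finally show ?thesis .
    qed
  qed
  show ?thesis
  proof (rule that[of "B ^ K"])
    show "B ^ K \<ge> 1" using B1 by simp
    fix n :: nat assume n: "n > 0"
    have "card (small n) \<le> card {..<K}" by (intro card_mono) (auto simp: small_def)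
    hence "B ^ card (small n) \<le> B ^ K" using B1 by (intro power_increasing) auto
    hence "B ^ card (small n) * real n powr \<epsilon> \<le> B ^ K * real n powr \<epsilon>" by (intro mult_right_mono) auto
    thus "real (card {d. d dvd n}) \<le> B ^ K * real n powr \<epsilon>" using main[OF n] by linarith
  qed
qed

section \<open>Squarefree numbers and Moebius sums\<close>

lemma squarefree_multiplicity_le_1:
  fixes d p :: nat
  assumes "squarefree d" "prime p"
  shows "multiplicity p d \<le> 1"
  using assms squarefree_factorial_semiring'' [of d] by (cases "d = 0") (auto simp: prime_factors_multiplicity)

lemma squarefree_prod_prime_factors:
  fixes d :: nat
  assumes "squarefree d"
  shows "\<Prod>(prime_factors d) = d"
proof -
  have d0: "d > 0" using assms by (cases d) auto
  have "d = (\<Prod>p\<in>prime_factors d. p ^ multiplicity p d)" using prime_factorization_nat[OF d0] .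
  also have "\<dots> = (\<Prod>p\<in>prime_factors d. p)"
  proof (intro prod.cong refl)
    fix p assume p: "p \<in> prime_factors d"
    hence "multiplicity p d = 1"
      using squarefree_multiplicity_le_1[OF assms, of p] by (auto simp: prime_factors_multiplicity)
    thus "p ^ multiplicity p d = p" by simp
  qed
  finally show ?thesis by simp
qed

lemma
  fixes X :: "nat set"
  assumes "finite X" "\<And>p. p \<in> X \<Longrightarrow> prime p"
  shows prime_factors_prod_primes: "prime_factors (\<Prod>X) = X"
    and squarefree_prod_primes: "squarefree (\<Prod>X)"
proof -
  have "0 \<notin> (\<lambda>x. x) ` X" using assms(2) by force
  hence "prime_factors (\<Prod>X) = (\<Union>p\<in>X. prime_factors p)"
    using prime_factors_prod[OF assms(1), of "\<lambda>x. x"] by simp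
  also have "\<dots> = (\<Union>p\<in>X. {p})" by (intro SUP_cong refl prime_prime_factors assms)
  finally show "prime_factors (\<Prod>X) = X" by simp
  show "squarefree (\<Prod>X)"
    using assms by (intro squarefree_prod_coprime) (auto intro: primes_coprime squarefree_prime)
qed

text \<open>Multiplying out gives a sum over subsets of \<open>P\<close>, and these correspond to
  squarefree numbers through their prime factors. The weight \<open>g\<close> is left free because
  two choices are used: \<open>g = 1\<close> for the divisor sum of the Moebius function and
  \<open>g p = 1 / p^2\<close> for the density constant.\<close>

lemma prod_one_minus_conv_moebius_sum:
  fixes g :: "nat \<Rightarrow> real"
  assumes "finite P" "\<And>p. p \<in> P \<Longrightarrow> prime p"
  shows "finite {d. squarefree d \<and> prime_factors d \<subseteq> P}"
    and "(\<Prod>p\<in>P. 1 - g p) =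
      (\<Sum>d | squarefree d \<and> prime_factors d \<subseteq> P. moebius_mu d * (\<Prod>p\<in>prime_factors d. g p))"
proof -
  have bij: "bij_betw (\<lambda>X. \<Prod>X) (Pow P) {d. squarefree d \<and> prime_factors d \<subseteq> P}"
  proof (rule bij_betw_byWitness[of _ prime_factors])
    show "\<forall>X\<in>Pow P. prime_factors (\<Prod>X) = X"
      using assms by (auto intro!: prime_factors_prod_primes simp: finite_subset subset_iff)
    show "\<forall>d\<in>{d. squarefree d \<and> prime_factors d \<subseteq> P}. \<Prod>(prime_factors d) = d"
      using squarefree_prod_prime_factors by blast
    show "(\<lambda>X. \<Prod>X) ` Pow P \<subseteq> {d. squarefree d \<and> prime_factors d \<subseteq> P}"
    proof clarify
      fix X assume X: "X \<subseteq> P"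
      hence "finite X" "\<And>p. p \<in> X \<Longrightarrow> prime p" using assms finite_subset by blast+
      from prime_factors_prod_primes[OF this] squarefree_prod_primes[OF this] X
      show "squarefree (\<Prod>X) \<and> prime_factors (\<Prod>X) \<subseteq> P" by simp
    qed
  qed auto
  show "finite {d. squarefree d \<and> prime_factors d \<subseteq> P}"
    using bij_betw_finite[OF bij] assms(1) by simp
  have "(\<Prod>p\<in>P. 1 - g p) = (\<Sum>X\<in>Pow P. (-1) ^ card X * (\<Prod>p\<in>X. g p))"
    using prod_diff_conv_sum[OF assms(1), of "\<lambda>_. 1" g] by simp
  also have "\<dots> = (\<Sum>X\<in>Pow P. moebius_mu (\<Prod>X) * (\<Prod>p\<in>prime_factors (\<Prod>X). g p))"
  proof (intro sum.cong refl)
    fix X assume X: "X \<in> Pow P"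
    hence "finite X" "\<And>p. p \<in> X \<Longrightarrow> prime p" using assms finite_subset by blast+
    from prime_factors_prod_primes[OF this] squarefree_prod_primes[OF this]
    show "(-1) ^ card X * (\<Prod>p\<in>X. g p) = moebius_mu (\<Prod>X) * (\<Prod>p\<in>prime_factors (\<Prod>X). g p)"
      by (simp add: moebius_mu_def)
  qed
  also have "\<dots> = (\<Sum>d | squarefree d \<and> prime_factors d \<subseteq> P. moebius_mu d * (\<Prod>p\<in>prime_factors d. g p))"
    by (rule sum.reindex_bij_betw[OF bij])
  finally show "(\<Prod>p\<in>P. 1 - g p) =
      (\<Sum>d | squarefree d \<and> prime_factors d \<subseteq> P. moebius_mu d * (\<Prod>p\<in>prime_factors d. g p))" .
qed

text \<open>For \<open>g = 1\<close> every factor of the product vanishes, so only the empty product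
  survives.\<close>

lemma sum_moebius_divisors:
  assumes "s > 0"
  shows "(\<Sum>d | d dvd s. real_of_int (moebius_mu d)) = (if s = 1 then 1 else 0)"
proof -
  have "(\<Sum>d | d dvd s. real_of_int (moebius_mu d)) = (\<Sum>d | squarefree d \<and> d dvd s. real_of_int (moebius_mu d))"
    using assms by (intro sum.mono_neutral_right) (auto simp: moebius_mu_def)
  also have "{d. squarefree d \<and> d dvd s} = {d. squarefree d \<and> prime_factors d \<subseteq> prime_factors s}"
  proof (intro Collect_cong conj_cong refl iffI)
    fix d assume "d dvd s" thus "prime_factors d \<subseteq> prime_factors s" using assms by (intro dvd_prime_factors) auto
  next
    fix d assume d: "squarefree d" "prime_factors d \<subseteq> prime_factors s"
    have "\<Prod>(prime_factors d) dvd \<Prod>(prime_factors s)"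
      using d(2) by (intro prod_dvd_prod_subset) auto
    also have "\<dots> dvd (\<Prod>p\<in>prime_factors s. p ^ multiplicity p s)"
      by (intro prod_dvd_prod dvd_power) (auto simp: prime_factors_multiplicity)
    also have "\<dots> = s" using prime_factorization_nat[OF assms] by simp
    finally have "\<Prod>(prime_factors d) dvd s" .
    thus "d dvd s" using squarefree_prod_prime_factors[OF d(1)] by simp
  qed
  also have "(\<Sum>d | squarefree d \<and> prime_factors d \<subseteq> prime_factors s. real_of_int (moebius_mu d)) = (\<Prod>p\<in>prime_factors s. 1 - 1)"
    by (subst prod_one_minus_conv_moebius_sum(2)) auto
  also have "\<dots> = (if s = 1 then 1 else 0)"
    using assms prime_factorization_empty_iff[of s] by (auto simp: card_gt_0_iff)
  finally show ?thesis .
qed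

text \<open>\<open>d^2\<close> divides \<open>n\<close> exactly if \<open>d\<close> divides
  \<open>square_part n\<close>, so the right-hand side is a full divisor sum, and it detects
  \<open>square_part n = 1\<close>.\<close>

lemma abs_moebius_conv_sum:
  assumes "n > 0"
  shows "real_of_int \<bar>moebius_mu n\<bar> = (\<Sum>d | d\<^sup>2 dvd n. real_of_int (moebius_mu d))"
proof -
  have "squarefree n \<longleftrightarrow> square_part n = 1"
  proof
    assume "squarefree n"
    thus "square_part n = 1" using squarefreeD[of n "square_part n"] by simp
  next
    assume 1: "square_part n = 1"
    show "squarefree n"
    proof (rule squarefreeI)
      fix x assume "x\<^sup>2 dvd n"
      hence "x dvd square_part n" by (simp only: dvd_square_part_iff)
      thus "x dvd 1" using 1 by simp
    qed
  qed
  hence "real_of_int \<bar>moebius_mu n\<bar> = (if square_part n = 1 then 1 else 0)" by (simp add: moebius_mu_def)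
  also have "\<dots> = (\<Sum>d | d dvd square_part n. real_of_int (moebius_mu d))"
    using assms by (intro sum_moebius_divisors[symmetric]) (metis gr0I square_part_0_iff less_irrefl)
  also have "\<dots> = (\<Sum>d | d\<^sup>2 dvd n. real_of_int (moebius_mu d))" by (simp only: dvd_square_part_iff)
  finally show ?thesis .
qed

lemma abs_moebius_le_1: "\<bar>real_of_int (moebius_mu d)\<bar> \<le> 1"
  by (simp add: moebius_mu_def)

text \<open>Telescoping: \<open>1 / d^2 \<le> 1 / (d - 1) - 1 / d\<close> for
  \<open>d > N\<close>.\<close>

lemma sum_inverse_squares_tail_le:
  fixes S :: "nat set"
  assumes "finite S" "\<And>d. d \<in> S \<Longrightarrow> d > N" "N > 0"
  shows "(\<Sum>d\<in>S. 1 / (real d)\<^sup>2) \<le> 1 / real N"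
proof -
  have tel: "(\<Sum>d\<in>{N<..N + k}. 1 / (real d)\<^sup>2) \<le> 1 / real N - 1 / real (N + k)" for k
  proof (induction k)
    case (Suc k)
    have "{N<..N + Suc k} = insert (N + Suc k) {N<..N + k}" by auto
    hence "(\<Sum>d\<in>{N<..N + Suc k}. 1 / (real d)\<^sup>2) = 1 / (real (N + Suc k))\<^sup>2 + (\<Sum>d\<in>{N<..N + k}. 1 / (real d)\<^sup>2)" by simp
    also have "1 / (real (N + Suc k))\<^sup>2 \<le> 1 / real (N + k) - 1 / real (N + Suc k)"
    proof -
      define x where "x = real (N + k)"
      have x: "x > 0" "real (N + Suc k) = x + 1" using assms(3) by (auto simp: x_def)
      have "1 / (x + 1)\<^sup>2 \<le> 1 / (x * (x + 1))"
        using x(1) by (intro divide_left_mono) (auto simp: power2_eq_square)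
      also have "\<dots> = 1 / x - 1 / (x + 1)" using x(1) by (simp add: field_simps)
      finally show ?thesis unfolding x(2) x_def[symmetric] .
    qed
    finally show ?case using Suc by simp
  qed simp
  obtain M where "S \<subseteq> {..M}" using assms(1) finite_nat_iff_bounded_le by blast
  hence "S \<subseteq> {N<..N + M}" using assms(2) by fastforce
  hence "(\<Sum>d\<in>S. 1 / (real d)\<^sup>2) \<le> (\<Sum>d\<in>{N<..N + M}. 1 / (real d)\<^sup>2)" by (intro sum_mono2) auto
  also have "\<dots> \<le> 1 / real N" using tel[of M] by (smt (verit) divide_nonneg_nonneg of_nat_0_le_iff)
  finally show ?thesis .
qed

text \<open>No infinite series is rearranged. The partial Euler product up to
  \<open>M \<ge> N\<close> expands into a finite sum over squarefree \<open>d\<close> whose primes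
  are at most \<open>M\<close> and do not divide \<open>q\<close>. It contains all squarefree
  \<open>d \<le> N\<close> coprime to \<open>q\<close>, and the surplus lies beyond
  \<open>N\<close>, so the bound is uniform in \<open>M\<close> and survives the limit.\<close>

lemma density_const_approx:
  assumes "N > 0" "q > 0"
  shows "\<bar>(\<Sum>d | d \<in> {1..N} \<and> coprime d q. moebius_mu d / (real d)\<^sup>2) - density_const q\<bar> \<le> 1 / real N"
proof -
  define T where "T = (\<Sum>d | d \<in> {1..N} \<and> coprime d q. moebius_mu d / (real d)\<^sup>2)"
  have fin: "\<bar>T - (\<Prod>p\<le>M. density_factor q p)\<bar> \<le> 1 / real N" if "M \<ge> N" for M
  proof -
    define P where "P = {p. prime p \<and> \<not> p dvd q \<and> p \<le> M}"
    define D where "D = {d. squarefree d \<and> prime_factors d \<subseteq> P}"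
    define A where "A = {d. d \<in> {1..N} \<and> coprime d q \<and> squarefree d}"
    have P: "finite P" "\<And>p. p \<in> P \<Longrightarrow> prime p" by (auto simp: P_def)
    have finD: "finite D" unfolding D_def by (rule prod_one_minus_conv_moebius_sum(1)[OF P])
    have "(\<Prod>p\<le>M. density_factor q p) = (\<Prod>p\<in>P. density_factor q p)"
      by (intro prod.mono_neutral_right) (auto simp: P_def density_factor_def)
    also have "\<dots> = (\<Prod>p\<in>P. 1 - 1 / (real p)\<^sup>2)" by (intro prod.cong) (auto simp: P_def density_factor_def)
    also have "\<dots> = (\<Sum>d\<in>D. moebius_mu d * (\<Prod>p\<in>prime_factors d. 1 / (real p)\<^sup>2))"
      unfolding D_def by (rule prod_one_minus_conv_moebius_sum(2)[OF P])
    also have "\<dots> = (\<Sum>d\<in>D. moebius_mu d / (real d)\<^sup>2)"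
    proof (intro sum.cong refl)
      fix d assume "d \<in> D"
      hence "(\<Prod>p\<in>prime_factors d. real p) = real d"
        using squarefree_prod_prime_factors[of d] by (simp add: D_def flip: of_nat_prod)
      hence "(\<Prod>p\<in>prime_factors d. 1 / (real p)\<^sup>2) = 1 / (real d)\<^sup>2"
        by (simp add: prod_dividef) (metis prod_power_distrib)
      thus "moebius_mu d * (\<Prod>p\<in>prime_factors d. 1 / (real p)\<^sup>2) = moebius_mu d / (real d)\<^sup>2" by simp
    qed
    also have "\<dots> = (\<Sum>d\<in>A. moebius_mu d / (real d)\<^sup>2) + (\<Sum>d\<in>D - A. moebius_mu d / (real d)\<^sup>2)"
    proof -
      have "A \<subseteq> D"
      proof
        fix d assume d: "d \<in> A"
        hence d': "d > 0" "d \<le> N" "coprime d q" "squarefree d" by (auto simp: A_def)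
        have "p \<in> P" if "p \<in> prime_factors d" for p
        proof -
          have p: "prime p" "p dvd d" using that by auto
          have "\<not> p dvd q" using p d'(3) coprime_common_divisor_nat[of d q p] by auto
          moreover have "p \<le> d" using p d' by (intro dvd_imp_le) auto
          ultimately show ?thesis using p d' \<open>M \<ge> N\<close> by (auto simp: P_def)
        qed
        thus "d \<in> D" using d' by (auto simp: D_def)
      qed
      thus ?thesis using finD by (simp add: sum.subset_diff)
    qed
    also have "(\<Sum>d\<in>A. moebius_mu d / (real d)\<^sup>2) = T"
      unfolding T_def A_def by (intro sum.mono_neutral_left) (auto simp: moebius_mu_def)
    finally have "\<bar>T - (\<Prod>p\<le>M. density_factor q p)\<bar> = \<bar>\<Sum>d\<in>D - A. moebius_mu d / (real d)\<^sup>2\<bar>" by simp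
    also have "\<dots> \<le> (\<Sum>d\<in>D - A. \<bar>moebius_mu d / (real d)\<^sup>2\<bar>)" by (rule sum_abs)
    also have "\<dots> \<le> (\<Sum>d\<in>D - A. 1 / (real d)\<^sup>2)"
      using abs_moebius_le_1 by (intro sum_mono) (simp add: divide_right_mono)
    also have "\<dots> \<le> 1 / real N"
    proof (rule sum_inverse_squares_tail_le)
      fix d assume d: "d \<in> D - A"
      have d0: "d > 0" using d by (cases d) (auto simp: D_def)
      have "coprime d q"
      proof (rule ccontr)
        assume "\<not> coprime d q"
        hence "gcd d q \<noteq> 1" using coprime_iff_gcd_eq_1 by blast
        then obtain p where "prime p" "p dvd gcd d q" by (rule prime_factor_nat[THEN exE]) blast
        hence p: "prime p" "p dvd d" "p dvd q" by auto
        hence "p \<in> prime_factors d" using d0 by (simp add: in_prime_factors_iff)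
        moreover have "prime_factors d \<subseteq> P" using d by (simp add: D_def)
        ultimately have "p \<in> P" by blast
        thus False using p(3) by (simp add: P_def)
      qed
      thus "d > N" using d d0 by (auto simp: D_def A_def)
    qed (use finD assms in auto)
    finally show ?thesis .
  qed
  have "(\<lambda>M. \<Prod>p\<le>M. density_factor q p) \<longlonglongrightarrow> density_const q"
    unfolding density_const_def by (rule convergent_prod_LIMSEQ[OF convergent_prod_density_factor])
  hence "(\<lambda>M. \<bar>T - (\<Prod>p\<le>M. density_factor q p)\<bar>) \<longlonglongrightarrow> \<bar>T - density_const q\<bar>" by (intro tendsto_intros)
  hence "\<bar>T - density_const q\<bar> \<le> 1 / real N" by (rule LIMSEQ_le_const2) (use fin in blast)
  thus ?thesis by (simp add: T_def)
qed

section \<open>Correlations of the discrepancies\<close>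

definition class_count :: "nat \<Rightarrow> nat \<Rightarrow> nat \<Rightarrow> nat \<Rightarrow> nat" where
  "class_count F q d a = card {m \<in> {0<..F}. [m * d\<^sup>2 = a] (mod q)}"

text \<open>The mean uses \<open>x / d^2\<close> itself and not its floor, so that the sum over
  \<open>d\<close> reproduces the truncated density series exactly.\<close>

definition class_dev :: "real \<Rightarrow> nat \<Rightarrow> nat \<Rightarrow> nat \<Rightarrow> real" where
  "class_dev x q d a = class_count (nat \<lfloor>x / (real d)\<^sup>2\<rfloor>) q d a - x / (real d)\<^sup>2 / q"

text \<open>Since \<open>d^2\<close> is a unit, \<open>q\<close> consecutive values of
  \<open>m\<close> meet every residue class exactly once.\<close>

lemma class_count_add_period:
  assumes "q > 0" "coprime d q"
  shows "class_count (F + q) q d a = class_count F q d a + 1"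
proof -
  define h where "h = (\<lambda>m. (m * d\<^sup>2) mod q)"
  have inj: "inj_on h {F<..F + q}"
  proof (rule linorder_inj_onI)
    fix m m' assume *: "m < m'" "m \<in> {F<..F + q}" "m' \<in> {F<..F + q}"
    show "h m \<noteq> h m'"
    proof
      assume "h m = h m'"
      hence "[m' * d\<^sup>2 = m * d\<^sup>2] (mod q)" by (simp add: h_def cong_def)
      moreover have "coprime (d\<^sup>2) q" using assms(2) by simp
      ultimately have "[m' = m] (mod q)" using cong_mult_rcancel_nat by blast
      hence "q dvd m' - m" using *(1) by (simp add: cong_altdef_nat)
      hence "q \<le> m' - m" using *(1) by (intro dvd_imp_le) auto
      thus False using * by auto
    qed
  qed auto
  have "h ` {F<..F + q} = {..<q}"
    using inj assms(1) by (intro card_subset_eq) (auto simp: h_def card_image)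
  hence "a mod q \<in> h ` {F<..F + q}" using assms(1) by simp
  then obtain m0 where m0: "m0 \<in> {F<..F + q}" "h m0 = a mod q" by auto
  have "{m \<in> {F<..F + q}. h m = a mod q} = {m0}" using m0 inj by (auto simp: inj_on_def)
  hence 1: "card {m \<in> {F<..F + q}. h m = a mod q} = 1" by simp
  have "{m \<in> {0<..F + q}. [m * d\<^sup>2 = a] (mod q)} =
        {m \<in> {0<..F}. [m * d\<^sup>2 = a] (mod q)} \<union> {m \<in> {F<..F + q}. h m = a mod q}"
    by (auto simp: h_def cong_def)
  hence "class_count (F + q) q d a = card ({m \<in> {0<..F}. [m * d\<^sup>2 = a] (mod q)} \<union> {m \<in> {F<..F + q}. h m = a mod q})"
    by (simp add: class_count_def)
  also have "\<dots> = class_count F q d a + card {m \<in> {F<..F + q}. h m = a mod q}"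
    unfolding class_count_def by (rule card_Un_disjoint) auto
  finally show ?thesis using 1 by simp
qed

lemma class_count_mod:
  assumes "q > 0" "coprime d q"
  shows "class_count F q d a = F div q + class_count (F mod q) q d a"
proof -
  have "class_count (r + n * q) q d a = n + class_count r q d a" for r n
  proof (induction n)
    case (Suc n)
    have "class_count (r + Suc n * q) q d a = class_count ((r + n * q) + q) q d a" by (simp add: algebra_simps)
    thus ?case using Suc class_count_add_period[OF assms] by simp
  qed simp
  from this[of "F mod q" "F div q"] show ?thesis by simp
qed

lemma class_count_conv_sum:
  assumes "a < q"
  shows "real (class_count F q d a) = (\<Sum>m\<in>{0<..F}. if a = (m * d\<^sup>2) mod q then 1 else 0)"
proof -
  have "{m \<in> {0<..F}. [m * d\<^sup>2 = a] (mod q)} = {m \<in> {0<..F}. a = (m * d\<^sup>2) mod q}"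
    using assms by (auto simp: cong_def)
  thus ?thesis by (simp add: class_count_def sum.If_cases Int_def)
qed

lemma sum_class_count:
  assumes "q > 0"
  shows "(\<Sum>a<q. real (class_count F q d a)) = F"
proof -
  have "(\<Sum>a<q. real (class_count F q d a)) = (\<Sum>a<q. \<Sum>m\<in>{0<..F}. if a = (m * d\<^sup>2) mod q then 1 else 0)"
    by (intro sum.cong refl class_count_conv_sum) auto
  also have "\<dots> = (\<Sum>m\<in>{0<..F}. \<Sum>a<q. if a = (m * d\<^sup>2) mod q then 1 else 0)" by (rule sum.swap)
  also have "\<dots> = (\<Sum>m\<in>{0<..F}. 1)" using assms by (intro sum.cong refl) simp
  finally show ?thesis by simp
qed

lemma sum_class_count_mult:
  assumes "q > 0"
  shows "(\<Sum>a<q. real (class_count F1 q d1 a) * real (class_count F2 q d2 a)) =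
    card {(m1, m2). m1 \<in> {0<..F1} \<and> m2 \<in> {0<..F2} \<and> [m1 * d1\<^sup>2 = m2 * d2\<^sup>2] (mod q)}"
proof -
  let ?r = "\<lambda>m d::nat. (m * d\<^sup>2) mod q"
  have "(\<Sum>a<q. real (class_count F1 q d1 a) * real (class_count F2 q d2 a)) =
    (\<Sum>a<q. \<Sum>(m1, m2)\<in>{0<..F1} \<times> {0<..F2}. if a = ?r m1 d1 then if a = ?r m2 d2 then 1 else 0 else 0)"
    by (intro sum.cong refl)
      (auto simp: class_count_conv_sum sum_product sum.cartesian_product intro!: sum.cong)
  also have "\<dots> = (\<Sum>p\<in>{0<..F1} \<times> {0<..F2}. \<Sum>a<q. if a = ?r (fst p) d1 then if a = ?r (snd p) d2 then 1 else 0 else 0)"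
    by (subst sum.swap) (simp add: case_prod_unfold)
  also have "\<dots> = (\<Sum>p\<in>{0<..F1} \<times> {0<..F2}. if ?r (fst p) d1 = ?r (snd p) d2 then 1 else 0)"
    using assms by (intro sum.cong refl) simp
  also have "\<dots> = card {p \<in> {0<..F1} \<times> {0<..F2}. ?r (fst p) d1 = ?r (snd p) d2}"
    by (simp add: sum.If_cases Int_def)
  also have "{p \<in> {0<..F1} \<times> {0<..F2}. ?r (fst p) d1 = ?r (snd p) d2} =
    {(m1, m2). m1 \<in> {0<..F1} \<and> m2 \<in> {0<..F2} \<and> [m1 * d1\<^sup>2 = m2 * d2\<^sup>2] (mod q)}"
    by (auto simp: cong_def)
  finally show ?thesis .
qed

text \<open>After substituting \<open>s * d1\<close> for \<open>d2\<close>, the unit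
  \<open>d1^2\<close> cancels from both sides.\<close>

lemma card_congruent_pairs_conv_lattice_pts:
  assumes "coprime d1 q" "[d2 = s * d1] (mod q)"
  shows "card {(m1, m2). m1 \<in> {0<..F1} \<and> m2 \<in> {0<..F2} \<and> [m1 * d1\<^sup>2 = m2 * d2\<^sup>2] (mod q)}
    = card (lattice_pts (int q) ((int s)\<^sup>2) {0<..int F1} {0<..int F2})"
proof -
  have iff: "[m1 * d1\<^sup>2 = m2 * d2\<^sup>2] (mod q) \<longleftrightarrow> [int m1 = (int s)\<^sup>2 * int m2] (mod int q)" for m1 m2
  proof -
    have "[m2 * d2\<^sup>2 = m2 * (s * d1)\<^sup>2] (mod q)" by (intro cong_mult cong_refl cong_pow assms)
    hence "[m1 * d1\<^sup>2 = m2 * d2\<^sup>2] (mod q) \<longleftrightarrow> [m1 * d1\<^sup>2 = m2 * (s * d1)\<^sup>2] (mod q)"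
      by (meson cong_sym cong_trans)
    also have "m2 * (s * d1)\<^sup>2 = (s\<^sup>2 * m2) * d1\<^sup>2" by (simp add: power_mult_distrib)
    also have "[m1 * d1\<^sup>2 = (s\<^sup>2 * m2) * d1\<^sup>2] (mod q) \<longleftrightarrow> [m1 = s\<^sup>2 * m2] (mod q)"
      using assms(1) by (intro cong_mult_rcancel_nat) simp
    also have "\<dots> \<longleftrightarrow> [int m1 = int (s\<^sup>2 * m2)] (mod int q)" by (simp only: cong_int_iff)
    finally show ?thesis by simp
  qed
  have "bij_betw (\<lambda>(m1, m2). (int m1, int m2))
     {(m1, m2). m1 \<in> {0<..F1} \<and> m2 \<in> {0<..F2} \<and> [m1 * d1\<^sup>2 = m2 * d2\<^sup>2] (mod q)}
     (lattice_pts (int q) ((int s)\<^sup>2) {0<..int F1} {0<..int F2})"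
    by (rule bij_betw_byWitness[of _ "\<lambda>(u, v). (nat u, nat v)"])
       (auto simp: iff lattice_pts_def)
  thus ?thesis by (rule bij_betw_same_card)
qed

text \<open>Write \<open>x / d^2 = q * (F d div q) + r d + \<theta> d\<close>. Whole periods cancel
  in the deviation, leaving a box with sides \<open>r d1\<close> and \<open>r d2\<close>, which are
  below \<open>q\<close> and at most \<open>Y\<close>. In the expanded product the terms linear in
  \<open>\<theta>\<close> cancel, and \<open>\<theta> d1 * \<theta> d2 / q\<close> is at most
  \<open>Y / l\<close>; together with the lattice discrepancy this makes 5 + 1 = 6.\<close>

lemma class_dev_correlation_le:
  assumes q: "q > 0" and x: "x \<ge> 0" and d: "coprime d1 q" "coprime d2 q"
    and s: "coprime s q" "[d2 = s * d1] (mod q)"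
    and Y: "Y \<ge> 1" "min (x / (real d1)\<^sup>2) q \<le> Y" "min (x / (real d2)\<^sup>2) q \<le> Y"
  shows "\<bar>\<Sum>a<q. class_dev x q d1 a * class_dev x q d2 a\<bar> \<le> 6 * Y / lattice_min (int q) ((int s)\<^sup>2)"
proof -
  define F where "F = (\<lambda>d. nat \<lfloor>x / (real d)\<^sup>2\<rfloor>)"
  define r where "r = (\<lambda>d. F d mod q)"
  define \<theta> where "\<theta> = (\<lambda>d. x / (real d)\<^sup>2 - F d)"
  define l where "l = lattice_min (int q) ((int s)\<^sup>2)"
  define c where "c = (\<lambda>d a. real (class_count (r d) q d a))"
  define \<beta> where "\<beta> = (\<lambda>d. (r d + \<theta> d) / q)"
  have F: "real (F d) \<le> x / (real d)\<^sup>2" "x / (real d)\<^sup>2 < real (F d) + 1" for d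
    unfolding F_def using x by (simp_all add: of_nat_nat)
  have \<theta>: "0 \<le> \<theta> d" "\<theta> d \<le> 1" for d using F[of d] by (auto simp: \<theta>_def)
  have rq: "r d < q" for d using q by (simp add: r_def)
  have rY: "real (r d) \<le> Y" if "min (x / (real d)\<^sup>2) q \<le> Y" for d
  proof -
    have "r d \<le> F d" by (simp add: r_def)
    hence "real (r d) \<le> x / (real d)\<^sup>2" using F(1)[of d] by linarith
    thus ?thesis using rq[of d] that by linarith
  qed
  have dev: "class_dev x q d a = c d a - \<beta> d" if "coprime d q" for d a
  proof -
    have "F d = q * (F d div q) + r d" by (simp add: r_def)
    hence "real (F d) = real q * real (F d div q) + r d" by (metis of_nat_add of_nat_mult)
    hence "x / (real d)\<^sup>2 = real q * real (F d div q) + r d + \<theta> d" by (simp add: \<theta>_def)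
    hence "x / (real d)\<^sup>2 / q = real (F d div q) + \<beta> d" using q by (simp add: \<beta>_def add_divide_distrib)
    moreover have "class_count (F d) q d a = F d div q + class_count (r d) q d a"
      unfolding r_def by (rule class_count_mod[OF q that])
    moreover have "nat \<lfloor>x / (real d)\<^sup>2\<rfloor> = F d" by (simp add: F_def)
    ultimately show ?thesis unfolding class_dev_def c_def by simp
  qed
  define N where "N = card (lattice_pts (int q) ((int s)\<^sup>2) {0<..int (r d1)} {0<..int (r d2)})"
  have sumc: "(\<Sum>a<q. c d a) = r d" for d unfolding c_def by (rule sum_class_count[OF q])
  have sumcc: "(\<Sum>a<q. c d1 a * c d2 a) = N"
    unfolding c_def N_def sum_class_count_mult[OF q]
    by (simp only: card_congruent_pairs_conv_lattice_pts[OF d(1) s(2)])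
  have "(\<Sum>a<q. class_dev x q d1 a * class_dev x q d2 a) = (\<Sum>a<q. (c d1 a - \<beta> d1) * (c d2 a - \<beta> d2))"
    using dev d by simp
  also have "\<dots> = (\<Sum>a<q. c d1 a * c d2 a) - \<beta> d2 * (\<Sum>a<q. c d1 a) - \<beta> d1 * (\<Sum>a<q. c d2 a) + q * (\<beta> d1 * \<beta> d2)"
    by (simp add: algebra_simps sum.distrib sum_subtractf sum_distrib_left)
  also have "\<dots> = N - real (r d1) * r d2 / q + \<theta> d1 * \<theta> d2 / q"
    unfolding sumc sumcc using q by (simp add: \<beta>_def field_simps)
  finally have eq: "(\<Sum>a<q. class_dev x q d1 a * class_dev x q d2 a) = N - real (r d1) * r d2 / q + \<theta> d1 * \<theta> d2 / q" .
  have "coprime ((int s)\<^sup>2) (int q)" using s(1) by simp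
  hence "\<bar>N - real (r d1) * r d2 / real_of_int (int q)\<bar> \<le> 5 * Y / l" unfolding N_def l_def
    by (rule lattice_discrepancy[rotated]) (use q rq rY Y in \<open>auto simp: less_imp_le\<close>)
  moreover have "\<bar>\<theta> d1 * \<theta> d2 / q\<bar> \<le> Y / l"
  proof -
    have "l\<^sup>2 \<le> q" using lattice_min_square_le[of "int q" "(int s)\<^sup>2"] q by (simp add: l_def)
    moreover have "l \<le> l\<^sup>2" by (simp add: power2_eq_square)
    ultimately have lq: "l \<le> q" by linarith
    have lpos: "l > 0" unfolding l_def using q by (intro lattice_min_pos) simp
    have "\<theta> d1 * \<theta> d2 \<le> 1" using \<theta> by (simp add: mult_le_one)
    hence "\<bar>\<theta> d1 * \<theta> d2 / q\<bar> \<le> 1 / q" using \<theta> q by (simp add: divide_right_mono)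
    also have "\<dots> \<le> Y / l" using lq lpos Y(1) by (intro frac_le) auto
    finally show ?thesis .
  qed
  ultimately have "\<bar>\<Sum>a<q. class_dev x q d1 a * class_dev x q d2 a\<bar> \<le> 5 * Y / l + Y / l" unfolding eq of_int_of_nat_eq by linarith
  also have "\<dots> = 6 * Y / l" by (simp add: field_simps)
  finally show ?thesis by (simp add: l_def)
qed

lemma card_dilation_pairs_le:
  assumes q: "q > 0" and s: "coprime s q" and B: "B \<subseteq> {0<..M}"
  shows "card {(d1, d2). d1 \<in> B \<and> d2 \<in> B \<and> [d2 = s * d1] (mod q)} \<le> real M * M / q + 5 * real M / lattice_min (int q) (int s)"
proof -
  have "card {(d1, d2). d1 \<in> B \<and> d2 \<in> B \<and> [d2 = s * d1] (mod q)} \<le> card (lattice_pts (int q) (int s) {0<..int M} {0<..int M})"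
  proof (rule card_inj_on_le[of "\<lambda>(d1, d2). (int d2, int d1)"])
    show "(\<lambda>(d1, d2). (int d2, int d1)) ` {(d1, d2). d1 \<in> B \<and> d2 \<in> B \<and> [d2 = s * d1] (mod q)}
       \<subseteq> lattice_pts (int q) (int s) {0<..int M} {0<..int M}"
      using B by (fastforce simp: lattice_pts_def simp flip: of_nat_mult cong_int_iff)
  qed (auto simp: inj_on_def)
  also have "real \<dots> \<le> real M * M / real_of_int (int q) + 5 * real M / lattice_min (int q) (int s)"
    using q s by (intro lattice_count_le) auto
  finally show ?thesis by simp
qed

text \<open>\<open>A\<close> bounds the sum of inverse squared minima over the units,
  \<open>2 * card {d. d dvd q} * A\<close> bounds the same sum taken at their squares, and
  \<open>W\<close> absorbs both. The constant is 60 = 6 * 5 * 2: 6 from the correlations, 5 from the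
  pair count after AM-GM, and 2 because \<open>Y * D^2 / sqrt q\<close> and \<open>Y * D\<close> are
  each at most \<open>x / sqrt q\<close>.\<close>

lemma block_variance_le:
  fixes x A W :: real and q D :: nat and c :: "nat \<Rightarrow> real"
  defines "A \<equiv> 24 * (1 + ln q)"
  defines "W \<equiv> 1 + A + 2 * card {d. d dvd q} * A"
  assumes q: "q > 0" "(real q)\<^sup>2 \<le> x" and D: "D > 0" "(real D)\<^sup>2 \<le> x"
    and B: "B \<subseteq> {D..<2 * D}" "\<And>d. d \<in> B \<Longrightarrow> coprime d q"
    and c: "\<And>d. d \<in> B \<Longrightarrow> \<bar>c d\<bar> \<le> 1"
  shows "(\<Sum>a<q. (\<Sum>d\<in>B. c d * class_dev x q d a)\<^sup>2) \<le> 60 * W * x / sqrt q"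
proof -
  define Y where "Y = min (x / (real D)\<^sup>2) q"
  define T where "T = totatives q"
  define l1 where "l1 = (\<lambda>s::nat. 1 / real (lattice_min (int q) (int s)))"
  define l2 where "l2 = (\<lambda>s::nat. 1 / real (lattice_min (int q) ((int s)\<^sup>2)))"
  define A' where "A' = 2 * card {d. d dvd q} * A"
  define corr where "corr = (\<lambda>d1 d2. \<Sum>a<q. class_dev x q d1 a * class_dev x q d2 a)"
  define P where "P = (\<lambda>s d1 d2::nat. [d2 = s * d1] (mod q))"
  have x0: "x \<ge> 0" using q(2) by (meson order_trans zero_le_power2)
  have finB: "finite B" using B(1) finite_subset by blast
  have finT: "finite T" by (simp add: T_def)
  have Y1: "Y \<ge> 1" using q D by (simp add: Y_def)
  have l0: "l1 s \<ge> 0" "l2 s \<ge> 0" for s by (simp_all add: l1_def l2_def)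
  have A0: "A \<ge> 0" using q by (simp add: A_def)
  hence A'0: "A' \<ge> 0" by (simp add: A'_def)
  have sum1: "(\<Sum>s\<in>T. (l1 s)\<^sup>2) \<le> A"
    using sum_inverse_lattice_min_square_le[OF q(1)] by (simp add: T_def l1_def A_def power_divide)
  have "(\<Sum>s\<in>T. (l2 s)\<^sup>2) \<le> 2 * card {d. d dvd q} * (\<Sum>s\<in>T. (l1 s)\<^sup>2)"
    using sum_inverse_lattice_min_of_square_le[OF q(1)] by (simp add: T_def l1_def l2_def power_divide)
  also have "\<dots> \<le> A'" unfolding A'_def using sum1 by (intro mult_left_mono) auto
  finally have sum2: "(\<Sum>s\<in>T. (l2 s)\<^sup>2) \<le> A'" .
  have YB: "min (x / (real d)\<^sup>2) q \<le> Y" if "d \<in> B" for d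
  proof -
    have "D \<le> d" using that B(1) by auto
    hence "x / (real d)\<^sup>2 \<le> x / (real D)\<^sup>2" using D x0 by (intro divide_left_mono power_mono) auto
    thus ?thesis by (simp add: Y_def min_def)
  qed

  \<comment> \<open>Every pair has a ratio among the units. Writing the bound as a sum over all
    \<open>s\<close> with the indicator \<open>P\<close> lets this sum be moved outside, where the
    pairs of given ratio are counted.\<close>
  have corr: "\<bar>corr d1 d2\<bar> \<le> (\<Sum>s\<in>T. if P s d1 d2 then 6 * Y * l2 s else 0)" if d: "d1 \<in> B" "d2 \<in> B" for d1 d2
  proof -
    have cop: "coprime d1 q" "coprime d2 q" using B(2) d by auto
    obtain e where e: "[int d1 * e = 1] (mod int q)"
      using cong_solve_coprime_int[of "int d1" "int q"] cop by auto
    have "coprime e (int q)" using e by (metis coprime_iff_invertible_int mult.commute)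
    hence "coprime (int d2 * e) (int q)" using cop by simp
    then obtain s where s: "s \<in> T" "[int d2 * e = int s] (mod int q)"
      using totatives_representative[OF q(1)] unfolding T_def by metis
    have "[int s * int d1 = int d2 * e * int d1] (mod int q)" using s(2) by (intro cong_mult cong_refl) (rule cong_sym)
    also have "int d2 * e * int d1 = int d2 * (int d1 * e)" by simp
    also have "[int d2 * (int d1 * e) = int d2 * 1] (mod int q)" by (intro cong_mult cong_refl e)
    finally have "[int d2 = int (s * d1)] (mod int q)" by (simp add: cong_sym)
    hence P: "[d2 = s * d1] (mod q)" by (simp only: cong_int_iff)
    have cs: "coprime s q" using s by (simp add: T_def in_totatives_iff)
    have "\<bar>corr d1 d2\<bar> \<le> 6 * Y / lattice_min (int q) ((int s)\<^sup>2)" unfolding corr_def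
      by (rule class_dev_correlation_le[OF q(1) x0 cop cs P Y1 YB[OF d(1)] YB[OF d(2)]])
    also have "\<dots> = (if P s d1 d2 then 6 * Y * l2 s else 0)" using P by (simp add: P_def l2_def)
    also have "\<dots> \<le> (\<Sum>s\<in>T. if P s d1 d2 then 6 * Y * l2 s else 0)"
      using s finT l0 Y1 by (intro member_le_sum) auto
    finally show ?thesis .
  qed

  have "(\<Sum>a<q. (\<Sum>d\<in>B. c d * class_dev x q d a)\<^sup>2)
    = (\<Sum>a<q. \<Sum>d1\<in>B. \<Sum>d2\<in>B. c d1 * c d2 * (class_dev x q d1 a * class_dev x q d2 a))"
    by (simp add: power2_eq_square sum_product mult_ac)
  also have "\<dots> = (\<Sum>d1\<in>B. \<Sum>a<q. \<Sum>d2\<in>B. c d1 * c d2 * (class_dev x q d1 a * class_dev x q d2 a))"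
    by (rule sum.swap)
  also have "\<dots> = (\<Sum>d1\<in>B. \<Sum>d2\<in>B. c d1 * c d2 * corr d1 d2)"
    unfolding corr_def sum_distrib_left by (intro sum.cong refl sum.swap)
  also have "\<dots> \<le> (\<Sum>d1\<in>B. \<Sum>d2\<in>B. \<Sum>s\<in>T. if P s d1 d2 then 6 * Y * l2 s else 0)"
  proof (intro sum_mono)
    fix d1 d2 assume d: "d1 \<in> B" "d2 \<in> B"
    have "c d1 * c d2 * corr d1 d2 \<le> \<bar>c d1\<bar> * \<bar>c d2\<bar> * \<bar>corr d1 d2\<bar>" by (metis abs_ge_self abs_mult)
    also have "\<dots> \<le> 1 * 1 * \<bar>corr d1 d2\<bar>" using c d by (intro mult_mono) auto
    finally show "c d1 * c d2 * corr d1 d2 \<le> (\<Sum>s\<in>T. if P s d1 d2 then 6 * Y * l2 s else 0)"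
      using corr[OF d] by simp
  qed
  also have "\<dots> = (\<Sum>p\<in>B \<times> B. \<Sum>s\<in>T. if P s (fst p) (snd p) then 6 * Y * l2 s else 0)"
    by (subst sum.cartesian_product) (simp only: case_prod_unfold)
  also have "\<dots> = (\<Sum>s\<in>T. \<Sum>p\<in>B \<times> B. if P s (fst p) (snd p) then 6 * Y * l2 s else 0)" by (rule sum.swap)
  also have "\<dots> = (\<Sum>s\<in>T. 6 * Y * l2 s * card {(d1, d2). d1 \<in> B \<and> d2 \<in> B \<and> P s d1 d2})"
  proof (intro sum.cong refl)
    fix s
    have "{p \<in> B \<times> B. P s (fst p) (snd p)} = {(d1, d2). d1 \<in> B \<and> d2 \<in> B \<and> P s d1 d2}" by auto
    thus "(\<Sum>p\<in>B \<times> B. if P s (fst p) (snd p) then 6 * Y * l2 s else 0) =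
        6 * Y * l2 s * card {(d1, d2). d1 \<in> B \<and> d2 \<in> B \<and> P s d1 d2}"
      using finB by (simp add: sum.If_cases Int_def)
  qed
  also have "\<dots> \<le> (\<Sum>s\<in>T. 6 * Y * (2 * (real D)\<^sup>2 / sqrt q * (1 / q + (l2 s)\<^sup>2) + 5 * D * ((l1 s)\<^sup>2 + (l2 s)\<^sup>2)))"
  proof (rule sum_mono)
    fix s assume s: "s \<in> T"
    have cs: "coprime s q" using s by (simp add: T_def in_totatives_iff)
    have "B \<subseteq> {0<..2 * D}" using B(1) D(1) by (auto dest!: subsetD)
    from card_dilation_pairs_le[OF q(1) cs this]
    have "card {(d1, d2). d1 \<in> B \<and> d2 \<in> B \<and> P s d1 d2} \<le> 4 * (real D)\<^sup>2 / q + 10 * D * l1 s"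
      by (simp add: P_def l1_def power2_eq_square)
    hence "6 * Y * l2 s * card {(d1, d2). d1 \<in> B \<and> d2 \<in> B \<and> P s d1 d2} \<le> 6 * Y * l2 s * (4 * (real D)\<^sup>2 / q + 10 * D * l1 s)"
      using Y1 l0 by (intro mult_left_mono) auto
    also have "\<dots> = 6 * Y * (4 * (real D)\<^sup>2 / q * l2 s + 5 * D * (2 * l1 s * l2 s))" by (simp add: algebra_simps)
    also have "\<dots> \<le> 6 * Y * (2 * (real D)\<^sup>2 / sqrt q * (1 / q + (l2 s)\<^sup>2) + 5 * D * ((l1 s)\<^sup>2 + (l2 s)\<^sup>2))"
    proof (intro mult_left_mono add_mono)
      show "2 * l1 s * l2 s \<le> (l1 s)\<^sup>2 + (l2 s)\<^sup>2" by (rule sum_squares_bound)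
      \<comment> \<open>The partner \<open>1 / sqrt q\<close> is chosen because its square, summed
        over at most \<open>q\<close> units, contributes only 1.\<close>
      have "2 * (1 / sqrt q) * l2 s \<le> (1 / sqrt q)\<^sup>2 + (l2 s)\<^sup>2" by (rule sum_squares_bound)
      hence "2 * (real D)\<^sup>2 / sqrt q * (2 * (1 / sqrt q) * l2 s) \<le> 2 * (real D)\<^sup>2 / sqrt q * (1 / q + (l2 s)\<^sup>2)"
        by (intro mult_left_mono) (auto simp: power_divide)
      moreover have "2 * (real D)\<^sup>2 / sqrt q * (2 * (1 / sqrt q) * l2 s) = 4 * (real D)\<^sup>2 / q * l2 s" by simp
      ultimately show "4 * (real D)\<^sup>2 / q * l2 s \<le> 2 * (real D)\<^sup>2 / sqrt q * (1 / q + (l2 s)\<^sup>2)" by linarith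
    qed (use Y1 in auto)
    finally show "6 * Y * l2 s * card {(d1, d2). d1 \<in> B \<and> d2 \<in> B \<and> P s d1 d2} \<le>
       6 * Y * (2 * (real D)\<^sup>2 / sqrt q * (1 / q + (l2 s)\<^sup>2) + 5 * D * ((l1 s)\<^sup>2 + (l2 s)\<^sup>2))" .
  qed
  also have "\<dots> = 6 * Y * (2 * (real D)\<^sup>2 / sqrt q * (card T / q + (\<Sum>s\<in>T. (l2 s)\<^sup>2)) + 5 * D * ((\<Sum>s\<in>T. (l1 s)\<^sup>2) + (\<Sum>s\<in>T. (l2 s)\<^sup>2)))"
    by (simp only: sum_distrib_left[symmetric] sum.distrib sum_constant times_divide_eq_right mult_1_right)
  also have "\<dots> \<le> 6 * Y * (2 * (real D)\<^sup>2 / sqrt q * (1 + A') + 5 * D * (A + A'))"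
  proof (intro mult_left_mono add_mono sum1 sum2)
    have "T \<subseteq> {0<..q}" unfolding T_def by (rule totatives_subset)
    hence "card T \<le> q" using card_mono[of "{0<..q}" T] by simp
    thus "card T / q \<le> 1" using q by simp
  qed (use Y1 in auto)
  also have "\<dots> \<le> 6 * Y * (5 * (real D)\<^sup>2 / sqrt q * W + 5 * D * W)"
    using Y1 A0 A'0 by (intro mult_left_mono add_mono mult_mono divide_right_mono) (auto simp: W_def A'_def)
  also have "\<dots> = 30 * W * (Y * (real D)\<^sup>2 / sqrt q + Y * D)" by (simp add: algebra_simps)
  also have "\<dots> \<le> 30 * W * (x / sqrt q + x / sqrt q)"
  proof (intro mult_left_mono add_mono divide_right_mono)
    have "Y \<le> x / (real D)\<^sup>2" by (simp add: Y_def)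
    thus YD: "Y * (real D)\<^sup>2 \<le> x" using D(1) by (simp add: field_simps)
    \<comment> \<open>Squaring combines \<open>Y \<le> q\<close> with
      \<open>Y * D^2 \<le> x\<close>; then \<open>q^2 \<le> x\<close> turns \<open>q * x\<close>
      into \<open>x^2 / q\<close>.\<close>
    show "Y * D \<le> x / sqrt q"
    proof (rule power2_le_imp_le)
      have "(Y * D)\<^sup>2 = Y * (Y * (real D)\<^sup>2)" by (simp add: power2_eq_square)
      also have "\<dots> \<le> q * x" using YD Y1 x0 by (intro mult_mono) (auto simp: Y_def)
      also have "\<dots> = (real q)\<^sup>2 * x / q" using q by (simp add: power2_eq_square)
      also have "\<dots> \<le> x * x / q" using q x0 by (intro divide_right_mono mult_right_mono) auto
      also have "\<dots> = (x / sqrt q)\<^sup>2" by (simp add: power_divide power2_eq_square)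
      finally show "(Y * D)\<^sup>2 \<le> (x / sqrt q)\<^sup>2" .
    qed (use x0 in simp)
    show "0 \<le> 30 * W" using A0 by (simp add: W_def)
  qed auto
  also have "\<dots> = 60 * W * x / sqrt q" by simp
  finally show ?thesis .
qed

section \<open>The variance\<close>

text \<open>The condition \<open>f q = f 0\<close> serves \<open>q = 1\<close>, where the only
  totative is 1 but the only residue is 0.\<close>

lemma totatives_sum_le_sum_residues:
  fixes f :: "nat \<Rightarrow> real"
  assumes "q > 0" "\<And>a. f a \<ge> 0" "f q = f 0"
  shows "(\<Sum>a\<in>totatives q. f a) \<le> (\<Sum>a<q. f a)"
proof (cases "q = 1")
  case True thus ?thesis using assms(3) by simp
next
  case False
  hence "totatives q \<subseteq> {..<q}" using assms(1) totatives_less[of _ q] by force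
  thus ?thesis using assms(2) by (intro sum_mono2) auto
qed

text \<open>Cauchy-Schwarz over the \<open>J\<close> dyadic blocks costs one factor
  \<open>J\<close>, and adding the block bounds costs another; \<open>J\<close> is at most
  \<open>2 * (1 + ln x)\<close>.\<close>

lemma sum_class_dev_variance_le:
  fixes x A W :: real and q :: nat and c :: "nat \<Rightarrow> real"
  defines "A \<equiv> 24 * (1 + ln q)"
  defines "W \<equiv> 1 + A + 2 * card {d. d dvd q} * A"
  assumes q: "q > 0" "(real q)\<^sup>2 \<le> x" and x: "x \<ge> 1"
    and D: "D \<subseteq> {1..nat \<lfloor>sqrt x\<rfloor>}" "\<And>d. d \<in> D \<Longrightarrow> coprime d q"
    and c: "\<And>d. d \<in> D \<Longrightarrow> \<bar>c d\<bar> \<le> 1"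
  shows "(\<Sum>a<q. (\<Sum>d\<in>D. c d * class_dev x q d a)\<^sup>2) \<le> (2 * (1 + ln x))\<^sup>2 * (60 * W * x / sqrt q)"
proof -
  define J where "J = nat \<lfloor>log 2 (sqrt x)\<rfloor> + 1"
  define V where "V = 60 * W * x / sqrt q"
  define B where "B = (\<lambda>j. D \<inter> {2 ^ j..<2 * 2 ^ j})"
  define X where "X = (\<lambda>j a. \<Sum>d\<in>B j. c d * class_dev x q d a)"
  have finD: "finite D" using D(1) finite_subset by blast
  have sx: "sqrt x \<ge> 1" using x by simp
  have l0: "log 2 (sqrt x) \<ge> 0" using sx by (simp add: zero_le_log_cancel_iff)
  have J2: "real J \<le> log 2 (sqrt x) + 1" using l0 by (simp add: J_def)
  have V0: "V \<ge> 0" using q x by (simp add: V_def W_def A_def)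
  have block: "(\<Sum>a<q. (X j a)\<^sup>2) \<le> V" if j: "j < J" for j
  proof -
    have "real j \<le> log 2 (sqrt x)" using j l0 unfolding J_def by linarith
    hence "2 powr real j \<le> 2 powr (log 2 (sqrt x))" by (intro powr_mono) auto
    hence "2 ^ j \<le> sqrt x" using sx by (simp add: powr_realpow)
    hence "(2 ^ j)\<^sup>2 \<le> (sqrt x)\<^sup>2" by (intro power_mono) auto
    hence "(real (2 ^ j))\<^sup>2 \<le> x" using x by simp
    thus ?thesis unfolding X_def V_def W_def A_def
      using D c q by (intro block_variance_le[where D = "2 ^ j"]) (auto simp: B_def)
  qed
  have split: "(\<Sum>d\<in>D. c d * class_dev x q d a) = (\<Sum>j<J. X j a)" for a
  proof -
    define e where "e = (\<lambda>d::nat. nat \<lfloor>log 2 d\<rfloor>)"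
    have e: "2 ^ e d \<le> d \<and> d < 2 * 2 ^ e d" if "d > 0" for d
    proof -
      have "log 2 d \<ge> 0" using that by (simp add: zero_le_log_cancel_iff)
      hence "real (e d) \<le> log 2 d" "log 2 d < real (e d) + 1" by (simp_all add: e_def)
      hence "2 powr (real (e d)) \<le> 2 powr (log 2 d)" "2 powr (log 2 d) < 2 powr (real (e d) + 1)" by auto
      hence "2 ^ e d \<le> real d" "real d < 2 * 2 ^ e d" using that by (simp_all add: powr_realpow powr_add)
      hence "real (2 ^ e d) \<le> real d" "real d < real (2 * 2 ^ e d)" by simp_all
      thus ?thesis by (simp only: of_nat_le_iff of_nat_less_iff)
    qed
    have uniq: "j = e d" if "2 ^ j \<le> d" "d < 2 * 2 ^ j" for j d
    proof -
      have d0: "d > 0" using that(1) by (cases d) auto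
      have "(2::nat) ^ j < 2 ^ Suc (e d)" using that(1) e[OF d0] by simp
      hence 1: "j < Suc (e d)" by (simp only: power_strict_increasing_iff)
      have "(2::nat) ^ e d < 2 ^ Suc j" using that(2) e[OF d0] by simp
      hence "e d < Suc j" by (simp only: power_strict_increasing_iff)
      with 1 show ?thesis by simp
    qed
    have eJ: "e d < J" if "d \<in> D" for d
    proof -
      have "d \<in> {1..nat \<lfloor>sqrt x\<rfloor>}" using that D(1) by blast
      hence "d > 0" "d \<le> nat \<lfloor>sqrt x\<rfloor>" by auto
      moreover from this(2) have "real d \<le> sqrt x" using sx by linarith
      ultimately have "log 2 d \<le> log 2 (sqrt x)" by (intro log_mono) auto
      thus ?thesis unfolding e_def J_def by (simp add: nat_mono floor_mono less_Suc_eq_le)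
    qed
    have "{d \<in> D. e d = j} = B j" for j
    proof -
      have "d > 0" if "d \<in> D" for d using that D(1) by auto
      thus ?thesis using e uniq by (force simp: B_def)
    qed
    moreover have "(\<Sum>d\<in>D. c d * class_dev x q d a) = (\<Sum>j<J. \<Sum>d\<in>{d \<in> D. e d = j}. c d * class_dev x q d a)"
      using eJ finD by (intro sum.group[symmetric]) auto
    ultimately show ?thesis by (simp add: X_def)
  qed
  have "(\<Sum>a<q. (\<Sum>d\<in>D. c d * class_dev x q d a)\<^sup>2) \<le> (\<Sum>a<q. J * (\<Sum>j<J. (X j a)\<^sup>2))"
    unfolding split using sum_squared_le_sum_of_squares[where I = "{..<J}"] by (intro sum_mono) (simp add: mult.commute)
  also have "\<dots> = J * (\<Sum>j<J. \<Sum>a<q. (X j a)\<^sup>2)" by (subst sum.swap) (simp add: sum_distrib_left)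
  also have "\<dots> \<le> J * (\<Sum>j<J. V)" by (intro mult_left_mono sum_mono block) auto
  also have "\<dots> = (real J)\<^sup>2 * V" by (simp add: power2_eq_square)
  also have "\<dots> \<le> (2 * (1 + ln x))\<^sup>2 * V"
  proof (intro mult_right_mono power_mono V0)
    have "log 2 (sqrt x) = ln x / (2 * ln 2)" using x by (simp add: log_def ln_sqrt)
    also have "\<dots> \<le> ln x / 1" using x ln2_ge_two_thirds by (intro divide_left_mono) auto
    finally show "real J \<le> 2 * (1 + ln x)" using J2 x by simp
  qed simp
  finally show ?thesis by (simp add: V_def)
qed

text \<open>Only \<open>d\<close> coprime to \<open>q\<close> occur, because \<open>d\<close>
  divides some \<open>n\<close> in the class of the unit \<open>a\<close>; the remaining multiples
  are written as \<open>n = m * d^2\<close>.\<close>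

lemma sqfree_sum_conv_class_count:
  assumes x: "x \<ge> 1" and q: "q > 0" and a: "coprime a q"
  shows "sqfree_sum x q a = (\<Sum>d | d \<in> {1..nat \<lfloor>sqrt x\<rfloor>} \<and> coprime d q.
           moebius_mu d * real (class_count (nat \<lfloor>x / (real d)\<^sup>2\<rfloor>) q d a))"
proof -
  define N where "N = nat \<lfloor>sqrt x\<rfloor>"
  define S where "S = {n::nat. 1 \<le> n \<and> real n \<le> x \<and> [n = a] (mod q)}"
  have finS: "finite S" by (rule finite_subset[of _ "{..nat \<lfloor>x\<rfloor>}"]) (use x in \<open>auto simp: S_def le_nat_iff le_floor_iff\<close>)
  have "sqfree_sum x q a = (\<Sum>n\<in>S. \<Sum>d\<in>{1..N}. if d\<^sup>2 dvd n then real_of_int (moebius_mu d) else 0)"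
    unfolding sqfree_sum_def S_def[symmetric]
  proof (intro sum.cong refl)
    fix n assume n: "n \<in> S"
    have "{d. d\<^sup>2 dvd n} = {d \<in> {1..N}. d\<^sup>2 dvd n}"
    proof (intro equalityI subsetI)
      fix d assume d: "d \<in> {d. d\<^sup>2 dvd n}"
      have n0: "n > 0" "real n \<le> x" using n by (auto simp: S_def)
      have "d\<^sup>2 \<le> n" using d n0 by (intro dvd_imp_le) auto
      hence "(real d)\<^sup>2 \<le> x" using n0 by (metis of_nat_le_iff of_nat_power order_trans)
      hence "real d \<le> sqrt x" by (rule real_le_rsqrt)
      hence "d \<le> N" using x by (simp add: N_def le_nat_iff le_floor_iff)
      moreover have "d \<noteq> 0" using d n0 by auto
      ultimately show "d \<in> {d \<in> {1..N}. d\<^sup>2 dvd n}" using d by auto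
    qed auto
    thus "real_of_int \<bar>moebius_mu n\<bar> = (\<Sum>d\<in>{1..N}. if d\<^sup>2 dvd n then real_of_int (moebius_mu d) else 0)"
      using abs_moebius_conv_sum[of n] n sum.inter_filter[of "{1..N}" "\<lambda>d. real_of_int (moebius_mu d)" "\<lambda>d. d\<^sup>2 dvd n"]
      by (simp add: S_def)
  qed
  also have "\<dots> = (\<Sum>d\<in>{1..N}. \<Sum>n\<in>S. if d\<^sup>2 dvd n then real_of_int (moebius_mu d) else 0)" by (rule sum.swap)
  also have "\<dots> = (\<Sum>d\<in>{1..N}. moebius_mu d * real (card {n \<in> S. d\<^sup>2 dvd n}))"
    using finS by (intro sum.cong refl) (simp add: sum.If_cases Int_def)
  also have "\<dots> = (\<Sum>d | d \<in> {1..N} \<and> coprime d q. moebius_mu d * real (card {n \<in> S. d\<^sup>2 dvd n}))"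
  proof (intro sum.mono_neutral_right ballI)
    fix d assume "d \<in> {1..N} - {d. d \<in> {1..N} \<and> coprime d q}"
    hence nc: "\<not> coprime d q" by auto
    have "{n \<in> S. d\<^sup>2 dvd n} = {}"
    proof (rule ccontr)
      assume "{n \<in> S. d\<^sup>2 dvd n} \<noteq> {}"
      then obtain n where n: "[n = a] (mod q)" "d\<^sup>2 dvd n" by (auto simp: S_def)
      hence "coprime n q" using a cong_imp_coprime cong_sym by blast
      moreover have "d dvd n" using n(2) by (meson dvd_power dvd_trans pos2)
      ultimately show False using nc coprime_divisors[of d n q q] by auto
    qed
    thus "moebius_mu d * real (card {n \<in> S. d\<^sup>2 dvd n}) = 0" by (simp only: card.empty of_nat_0 mult_zero_right)
  qed auto
  also have "\<dots> = (\<Sum>d | d \<in> {1..N} \<and> coprime d q. moebius_mu d * real (class_count (nat \<lfloor>x / (real d)\<^sup>2\<rfloor>) q d a))"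
  proof (intro sum.cong refl)
    fix d assume "d \<in> {d. d \<in> {1..N} \<and> coprime d q}"
    hence d: "d > 0" by auto
    have iff: "m \<le> nat \<lfloor>x / (real d)\<^sup>2\<rfloor> \<longleftrightarrow> real (m * d\<^sup>2) \<le> x" for m
    proof -
      have "m \<le> nat \<lfloor>x / (real d)\<^sup>2\<rfloor> \<longleftrightarrow> real m \<le> x / (real d)\<^sup>2"
        using x by (simp add: le_nat_iff le_floor_iff)
      also have "\<dots> \<longleftrightarrow> real (m * d\<^sup>2) \<le> x" using d by (simp add: field_simps)
      finally show ?thesis .
    qed
    have "bij_betw (\<lambda>m. m * d\<^sup>2) {m \<in> {0<..nat \<lfloor>x / (real d)\<^sup>2\<rfloor>}. [m * d\<^sup>2 = a] (mod q)} {n \<in> S. d\<^sup>2 dvd n}"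
      by (rule bij_betw_byWitness[of _ "\<lambda>n. n div d\<^sup>2"])
         (use d in \<open>auto simp: S_def iff dvd_div_mult_self simp del: of_nat_mult intro!: Nat.gr0I\<close>)
    hence "card {n \<in> S. d\<^sup>2 dvd n} = class_count (nat \<lfloor>x / (real d)\<^sup>2\<rfloor>) q d a"
      unfolding class_count_def by (rule bij_betw_same_card[symmetric])
    thus "moebius_mu d * real (card {n \<in> S. d\<^sup>2 dvd n}) = moebius_mu d * real (class_count (nat \<lfloor>x / (real d)\<^sup>2\<rfloor>) q d a)"
      by simp
  qed
  finally show ?thesis by (simp add: N_def)
qed

text \<open>The error splits into the weighted deviations and \<open>x / q * R\<close>, with
  \<open>R\<close> the truncation error of the density series. By
  \<open>(y + z)^2 \<le> 2 * y^2 + 2 * z^2\<close> the constant is 488 = 2 * 4 * 60 + 8, where 4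
  comes from the squared number of blocks and 8 from \<open>R\<close>.\<close>

lemma sqfree_error_variance_le:
  fixes x A W :: real and q :: nat
  defines "A \<equiv> 24 * (1 + ln q)"
  defines "W \<equiv> 1 + A + 2 * card {d. d dvd q} * A"
  assumes q: "q > 0" "(real q)\<^sup>2 \<le> x" and x: "x \<ge> 1"
  shows "(\<Sum>a\<in>totatives q. (sqfree_error x q a)\<^sup>2) \<le> 488 * (1 + ln x)\<^sup>2 * W * x / sqrt q"
proof -
  define N where "N = nat \<lfloor>sqrt x\<rfloor>"
  define D where "D = {d. d \<in> {1..N} \<and> coprime d q}"
  define X where "X = (\<lambda>a. \<Sum>d\<in>D. moebius_mu d * class_dev x q d a)"
  define R where "R = (\<Sum>d\<in>D. moebius_mu d / (real d)\<^sup>2) - density_const q"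
  have sx: "sqrt x \<ge> 1" using x by simp
  have N: "N > 0" "sqrt x \<le> 2 * N"
  proof -
    have "\<lfloor>sqrt x\<rfloor> \<ge> 1" using sx by simp
    thus "N > 0" by (simp add: N_def)
    hence "real N \<ge> 1" by simp
    moreover have "sqrt x < real N + 1" unfolding N_def using sx by linarith
    ultimately show "sqrt x \<le> 2 * N" by linarith
  qed
  have W1: "W \<ge> 1" using q by (simp add: W_def A_def)
  have "\<bar>R\<bar> \<le> 1 / N" unfolding R_def D_def by (rule density_const_approx[OF N(1) q(1)])
  also have "1 / real N = 2 / (2 * N)" by simp
  also have "\<dots> \<le> 2 / sqrt x" using N sx by (intro frac_le) linarith+
  finally have R: "\<bar>R\<bar> \<le> 2 / sqrt x" .
  have err: "sqfree_error x q a = X a + x / q * R" if "a \<in> totatives q" for a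
  proof -
    have "coprime a q" using that by (simp add: in_totatives_iff)
    hence S: "sqfree_sum x q a = (\<Sum>d\<in>D. moebius_mu d * real (class_count (nat \<lfloor>x / (real d)\<^sup>2\<rfloor>) q d a))"
      unfolding D_def N_def by (rule sqfree_sum_conv_class_count[OF x q(1)])
    have "X a = sqfree_sum x q a - (\<Sum>d\<in>D. x / q * (moebius_mu d / (real d)\<^sup>2))"
      unfolding S X_def class_dev_def sum_subtractf[symmetric] by (intro sum.cong refl) (simp add: algebra_simps)
    also have "(\<Sum>d\<in>D. x / q * (moebius_mu d / (real d)\<^sup>2)) = x / q * (R + density_const q)"
      by (simp only: sum_distrib_left[symmetric] R_def diff_add_cancel)
    finally show ?thesis by (simp add: sqfree_error_def ring_distribs)
  qed
  have tail: "(x / q * R)\<^sup>2 \<le> 4 * x / (real q)\<^sup>2"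
  proof -
    have "\<bar>x / q * R\<bar> = x / q * \<bar>R\<bar>" using x by (simp add: abs_mult)
    also have "\<dots> \<le> x / q * (2 / sqrt x)" using R x by (intro mult_left_mono) auto
    finally have "\<bar>x / q * R\<bar> \<le> x / q * (2 / sqrt x)" .
    hence "(x / q * R)\<^sup>2 \<le> (x / q * (2 / sqrt x))\<^sup>2" by (metis abs_ge_zero power2_abs power_mono)
    also have "x / q * (2 / sqrt x) = 2 * (x / sqrt x) / q" by (simp add: mult_ac)
    also have "\<dots> = 2 * sqrt x / q" using x by (simp only: real_div_sqrt)
    also have "\<dots>\<^sup>2 = 4 * x / (real q)\<^sup>2" using x by (simp add: power_mult_distrib power_divide)
    finally show ?thesis .
  qed
  have "(\<Sum>a\<in>totatives q. (sqfree_error x q a)\<^sup>2) \<le> (\<Sum>a\<in>totatives q. 2 * (X a)\<^sup>2 + 2 * (4 * x / (real q)\<^sup>2))"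
  proof (rule sum_mono)
    fix a assume a: "a \<in> totatives q"
    have "(X a + x / q * R)\<^sup>2 \<le> 2 * (X a)\<^sup>2 + 2 * (x / q * R)\<^sup>2"
      using sum_squares_bound[of "X a" "x / q * R"] by (simp add: power2_sum)
    thus "(sqfree_error x q a)\<^sup>2 \<le> 2 * (X a)\<^sup>2 + 2 * (4 * x / (real q)\<^sup>2)" using err[OF a] tail by simp
  qed
  also have "\<dots> = 2 * (\<Sum>a\<in>totatives q. (X a)\<^sup>2) + totient q * (2 * (4 * x / (real q)\<^sup>2))"
    by (simp add: sum.distrib sum_distrib_left totient_def)
  also have "\<dots> \<le> 2 * ((2 * (1 + ln x))\<^sup>2 * (60 * W * x / sqrt q)) + q * (2 * (4 * x / (real q)\<^sup>2))"
  proof (intro add_mono mult_left_mono mult_right_mono)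
    have "X q = X 0" by (simp add: X_def class_dev_def class_count_def cong_def)
    hence "(\<Sum>a\<in>totatives q. (X a)\<^sup>2) \<le> (\<Sum>a<q. (X a)\<^sup>2)"
      using q by (intro totatives_sum_le_sum_residues) auto
    also have "\<dots> \<le> (2 * (1 + ln x))\<^sup>2 * (60 * W * x / sqrt q)"
      unfolding X_def W_def A_def
      by (rule sum_class_dev_variance_le[OF q x]) (auto simp: D_def N_def abs_moebius_le_1)
    finally show "(\<Sum>a\<in>totatives q. (X a)\<^sup>2) \<le> (2 * (1 + ln x))\<^sup>2 * (60 * W * x / sqrt q)" .
    show "real (totient q) \<le> real q" by (simp add: totient_le)
  qed (use x in auto)
  also have "q * (2 * (4 * x / (real q)\<^sup>2)) = 8 * x / q" using q by (simp add: power2_eq_square)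
  also have "\<dots> \<le> 8 * x / sqrt q"
  proof (intro divide_left_mono)
    have "sqrt q * 1 \<le> sqrt q * sqrt q" using q by (intro mult_left_mono) auto
    thus "sqrt q \<le> q" by simp
  qed (use q x in auto)
  also have "\<dots> \<le> 8 * ((1 + ln x)\<^sup>2 * W * x / sqrt q)"
  proof -
    have "1 * 1 \<le> (1 + ln x)\<^sup>2 * W" using W1 x by (intro mult_mono one_le_power) auto
    hence "1 * (x / sqrt q) \<le> (1 + ln x)\<^sup>2 * W * (x / sqrt q)" using x by (intro mult_right_mono) auto
    thus ?thesis by simp
  qed
  also have "2 * ((2 * l)\<^sup>2 * (60 * W * x / s)) + 8 * (l\<^sup>2 * W * x / s) = 488 * l\<^sup>2 * W * x / s" for l s :: real
    by (simp add: power_mult_distrib flip: add_divide_distrib)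
  finally show ?thesis by simp
qed

text \<open>In Gauss's identity, \<open>q\<close> as the sum of \<open>totient d\<close> over its
  divisors, every term is at most \<open>totient q\<close>.\<close>

lemma self_le_card_divisors_mult_totient: "q \<le> card {d. d dvd q} * totient q"
proof (cases "q = 0")
  case False
  have "q = (\<Sum>d | d dvd q. totient d)" by (rule totient_divisor_sum[symmetric])
  also have "\<dots> \<le> (\<Sum>d | d dvd q. totient q)"
    using False by (intro sum_mono totient_dvd_mono) auto
  finally show ?thesis by simp
qed simp

theorem corollary3:
  fixes \<epsilon> :: real
  assumes "\<epsilon> > 0"
  shows "\<exists>C>0. \<forall>(x::real) (q::nat).
           x \<ge> 1 \<longrightarrow> q \<ge> 1 \<longrightarrow> real q \<le> x powr (1/2) \<longrightarrow>
           1 / real (totient q) *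
             real (card {a \<in> totatives q.
                           \<bar>sqfree_error x q a\<bar> > x powr (1/2 + \<epsilon>) / real q powr (3/4)})
           \<le> C * x powr (-\<epsilon>)"
proof -
  \<comment> \<open>Three logarithms and two divisor functions cost a factor
    \<open>x powr \<delta>\<close> each, and the five together may cost
    \<open>x powr \<epsilon>\<close>.\<close>
  define \<delta> where "\<delta> = \<epsilon> / 5"
  \<comment> \<open>From \<open>1 \<le> x powr \<delta>\<close> and
    \<open>ln x \<le> x powr \<delta> / \<delta>\<close>, so that
    \<open>1 + ln x \<le> K * x powr \<delta>\<close>.\<close>
  define K where "K = 1 + 1 / \<delta>"
  have \<delta>: "\<delta> > 0" using assms by (simp add: \<delta>_def)
  obtain C where C: "C \<ge> 1" "\<And>n::nat. n > 0 \<Longrightarrow> real (card {d. d dvd n}) \<le> C * real n powr \<delta>"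
    using divisor_bound[OF \<delta>] by blast
  have K: "K > 0" using \<delta> by (simp add: K_def add_pos_pos)
  show ?thesis
  \<comment> \<open>35624 = 488 * 73: the constant of the variance times that of \<open>WL\<close>,
    where 73 = 1 + 24 + 48.\<close>
  proof (intro exI[of _ "35624 * K ^ 3 * C\<^sup>2"] conjI allI impI)
    show "35624 * K ^ 3 * C\<^sup>2 > 0" using K C by simp
    fix x :: real and q :: nat
    assume x: "x \<ge> 1" and "q \<ge> 1" and qx: "real q \<le> x powr (1/2)"
    hence q: "q > 0" by simp
    define \<tau> where "\<tau> = real (card {d. d dvd q})"
    define L where "L = 1 + ln x"
    define W where "W = 1 + 24 * (1 + ln q) + 2 * \<tau> * (24 * (1 + ln q))"
    define T where "T = x powr (1/2 + \<epsilon>) / real q powr (3/4)"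
    define bad where "bad = {a \<in> totatives q. \<bar>sqfree_error x q a\<bar> > T}"
    have "(real q)\<^sup>2 \<le> (x powr (1/2))\<^sup>2" using qx by (intro power_mono) auto
    hence q2: "(real q)\<^sup>2 \<le> x" using x by (simp add: powr_half_sqrt)
    have "real q * 1 \<le> real q * real q" using q by (intro mult_left_mono) auto
    hence qx': "real q \<le> x" using q2 by (simp add: power2_eq_square)
    have L1: "L \<ge> 1" using x by (simp add: L_def)
    have "card {d. d dvd q} > 0" using q by (simp add: card_gt_0_iff) auto
    hence \<tau>1: "\<tau> \<ge> 1" by (simp add: \<tau>_def)
    have W0: "W \<ge> 0" using q \<tau>1 by (simp add: W_def)
    have WL: "W \<le> 73 * L * \<tau>"
    proof -
      have "1 + ln q \<le> L" using q qx' by (simp add: L_def)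
      hence "W \<le> 1 + 24 * L + 2 * \<tau> * (24 * L)" unfolding W_def using \<tau>1 by (intro add_mono mult_left_mono) auto
      also have "\<dots> = 1 + 24 * L + 48 * (L * \<tau>)" by simp
      also have "\<dots> \<le> 73 * (L * \<tau>)"
        using L1 mult_left_mono[OF \<tau>1, of L] by linarith
      finally show ?thesis by simp
    qed
    have T0: "T > 0" using x q by (simp add: T_def)
    \<comment> \<open>Up to \<open>q * x powr (- 2 * \<epsilon>)\<close>, the size
      \<open>x / sqrt q\<close> of the variance equals \<open>T^2\<close>. This balance accounts for
      the exponent 3/4 of \<open>q\<close> in the threshold.\<close>
    have T2: "T\<^sup>2 = x * x powr (2 * \<epsilon>) / (q * sqrt q)"
    proof -
      have "(x powr (1/2 + \<epsilon>))\<^sup>2 = x powr (1 + 2 * \<epsilon>)" using x by (simp add: power2_eq_square flip: powr_add)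
      also have "\<dots> = x * x powr (2 * \<epsilon>)" using x by (simp add: powr_add)
      finally have 1: "(x powr (1/2 + \<epsilon>))\<^sup>2 = x * x powr (2 * \<epsilon>)" .
      have "(real q powr (3/4))\<^sup>2 = real q powr (1 + 1/2)" by (simp add: power2_eq_square flip: powr_add)
      also have "\<dots> = q * sqrt q" using q by (simp only: powr_add powr_half_sqrt of_nat_0_le_iff) simp
      finally show ?thesis by (simp add: T_def power_divide 1)
    qed
    have "card bad * T\<^sup>2 = (\<Sum>a\<in>bad. T\<^sup>2)" by simp
    also have "\<dots> \<le> (\<Sum>a\<in>bad. (sqfree_error x q a)\<^sup>2)"
    proof (rule sum_mono)
      fix a assume "a \<in> bad"
      hence "T\<^sup>2 \<le> \<bar>sqfree_error x q a\<bar>\<^sup>2" using T0 by (intro power_mono) (auto simp: bad_def)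
      thus "T\<^sup>2 \<le> (sqfree_error x q a)\<^sup>2" by simp
    qed
    also have "\<dots> \<le> (\<Sum>a\<in>totatives q. (sqfree_error x q a)\<^sup>2)" by (intro sum_mono2) (auto simp: bad_def)
    also have "\<dots> \<le> 488 * L\<^sup>2 * W * x / sqrt q"
      using sqfree_error_variance_le[OF q q2 x] by (simp add: L_def W_def \<tau>_def)
    also have "\<dots> \<le> 488 * L\<^sup>2 * (73 * L * \<tau>) * x / sqrt q"
      using WL x by (intro divide_right_mono mult_right_mono mult_left_mono) auto
    also have "\<dots> = (35624 * L ^ 3 * \<tau> * q * x powr (- 2 * \<epsilon>)) * T\<^sup>2"
    proof -
      have "x powr (- 2 * \<epsilon>) * x powr (2 * \<epsilon>) = 1" using x by (simp flip: powr_add)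
      hence "x / sqrt q = (x powr (- 2 * \<epsilon>) * x powr (2 * \<epsilon>)) * x / sqrt q" by simp
      also have "\<dots> = q * x powr (- 2 * \<epsilon>) * T\<^sup>2" unfolding T2 using q by simp
      finally have "x / sqrt q = q * x powr (- 2 * \<epsilon>) * T\<^sup>2" .
      hence "35624 * L ^ 3 * \<tau> * (x / sqrt q) = 35624 * L ^ 3 * \<tau> * (q * x powr (- 2 * \<epsilon>) * T\<^sup>2)" by simp
      moreover have "488 * L\<^sup>2 * (73 * L * \<tau>) * x / sqrt q = 35624 * L ^ 3 * \<tau> * (x / sqrt q)"
        by (simp add: power2_eq_square power3_eq_cube)
      ultimately show ?thesis by (simp only: mult.assoc)
    qed
    finally have "card bad * T\<^sup>2 \<le> (35624 * L ^ 3 * \<tau> * q * x powr (- 2 * \<epsilon>)) * T\<^sup>2" .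
    hence bad: "card bad \<le> 35624 * L ^ 3 * \<tau> * q * x powr (- 2 * \<epsilon>)" using T0 by simp
    have tot: "totient q > 0" using q by simp
    have "real q \<le> \<tau> * real (totient q)" unfolding \<tau>_def
      using self_le_card_divisors_mult_totient[of q] by (simp flip: of_nat_mult)
    hence "real q / totient q \<le> \<tau>" using tot by (simp add: field_simps)
    \<comment> \<open>The second divisor function enters here, through \<open>q / totient q\<close>;
      the first one came from \<open>W\<close>.\<close>
    hence tot_le: "real q / totient q * (35624 * L ^ 3 * \<tau> * x powr (- 2 * \<epsilon>)) \<le> \<tau> * (35624 * L ^ 3 * \<tau> * x powr (- 2 * \<epsilon>))"
      using L1 \<tau>1 by (intro mult_right_mono) auto
    have "1 / real (totient q) * card bad \<le> 1 / real (totient q) * (35624 * L ^ 3 * \<tau> * q * x powr (- 2 * \<epsilon>))"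
      using bad by (intro mult_left_mono) auto
    also have "\<dots> = real q / totient q * (35624 * L ^ 3 * \<tau> * x powr (- 2 * \<epsilon>))" by simp
    also note tot_le
    also have "\<tau> * (35624 * L ^ 3 * \<tau> * x powr (- 2 * \<epsilon>)) = 35624 * (L ^ 3 * \<tau>\<^sup>2) * x powr (- 2 * \<epsilon>)"
      by (simp add: power2_eq_square)
    also have "\<dots> \<le> 35624 * ((K * x powr \<delta>) ^ 3 * (C * x powr \<delta>)\<^sup>2) * x powr (- 2 * \<epsilon>)"
    proof (intro mult_right_mono mult_left_mono mult_mono power_mono)
      have "1 \<le> x powr \<delta>" using x \<delta> by (simp add: ge_one_powr_ge_zero)
      moreover have "ln x \<le> x powr \<delta> / \<delta>" using ln_powr_bound[OF x \<delta>] .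
      ultimately show "L \<le> K * x powr \<delta>" by (simp add: L_def K_def distrib_right)
      have "\<tau> \<le> C * real q powr \<delta>" unfolding \<tau>_def using C(2) q by blast
      also have "\<dots> \<le> C * x powr \<delta>" using C qx' \<delta> by (intro mult_left_mono powr_mono2) auto
      finally show "\<tau> \<le> C * x powr \<delta>" .
    qed (use L1 \<tau>1 K in auto)
    also have "\<dots> = 35624 * K ^ 3 * C\<^sup>2 * ((x powr \<delta>) ^ 5 * x powr (- 2 * \<epsilon>))"
      by (simp add: power_mult_distrib power2_eq_square power3_eq_cube eval_nat_numeral)
    also have "(x powr \<delta>) ^ 5 * x powr (- 2 * \<epsilon>) = x powr (- \<epsilon>)"
      using x by (simp add: powr_power \<delta>_def flip: powr_add)
    finally show "1 / real (totient q) *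
             real (card {a \<in> totatives q.
                           \<bar>sqfree_error x q a\<bar> > x powr (1/2 + \<epsilon>) / real q powr (3/4)})
           \<le> 35624 * K ^ 3 * C\<^sup>2 * x powr (-\<epsilon>)"
      unfolding bad_def T_def .
  qed
qed

end
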